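(* There is a Turing functional $\Phi$ such that for every tree $T\subseteq\omega^{<\omega}$, $\Phi^{T'}$ computes a pair of reals $A,B$ (depending on $T$) such that $A\geq_g B$ if and only if $T$ is well-founded. Consequently, the relation $\geq_g$, viewed as a set of pairs of reals, is $\mathbf{\Pi}^1_1$-complete.
   Context: Reals are subsets of $\mathbb{N}$; $n=\{0,\dots,n-1\}$; a real is density-1 if $\lim_{n\to\infty}|A\cap n|/n=1$. A tree $T\subseteq\omega^{<\omega}$ (a set of finite sequences of naturals closed under initial segments, coded as a real) is well-founded if it has no infinite path; $T'$ denotes the Turing jump of $T$. A partial oracle for a real $C$ is a set $(C)$ of triples $\langle n,x,l\rangle$ (coded as naturals, so usable as a Turing oracle) such that $\langle n,0,l\rangle\in(C)$ implies $n\notin C$ and $\langle n,1,l\rangle\in(C)$ implies $n\in C$; $\mathrm{dom}((C))=\{n:\exists x,l\ \langle n,x,l\rangle\in(C)\}$. A generic oracle for $C$ is a partial oracle for $C$ with density-1 domain. $\varphi^X$ is a generic computation of $D$ if $\mathrm{dom}(\varphi^X)$ is density-1, $\varphi^X$ has values in $\{0,1\}$, and agrees with $D$ on its domain. $C\geq_g D$ if there is a single Turing functional $\varphi$ such that for every generic oracle $(C)$ for $C$, $\varphi^{(C)}$ is a generic computation of $D$. $\mathbf{\Pi}^1_1$-complete means the set is $\mathbf{\Pi}^1_1$ and every $\mathbf{\Pi}^1_1$ set (e.g. the set of well-founded trees) Borel-reduces to it.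
   Formalization: Triples ⟨n,x,l⟩ of a partial oracle must have x in {0,1}; otherwise {⟨n,2,0⟩} is a generic oracle for every real and the claim fails. In completeness, Π¹₁ sets range over Polish spaces carried by subsets of P(ℕ), which include a homeomorphic copy of every Polish space. *)

theory Defs
  imports "HOL-Analysis.Analysis" "HOL-Library.Nat_Bijection"
begin

text \<open>
  Reals in the sense of computability theory are elements of type \<^typ>\<open>nat set\<close>.
  Pairs and finite sequences of naturals are coded by the bijections \<^const>\<open>prod_encode\<close> and
  \<^const>\<open>list_encode\<close>.
\<close>

section \<open>Turing functionals and the Turing jump\<close>

text \<open>
  Turing functionals are given as programs for unary partial recursive functions with an oracle;
  functions of several arguments take \<^const>\<open>prod_encode\<close>-tuples. The identity is
  \<open>Tuple First Second\<close>, because \<^const>\<open>prod_encode\<close> is onto.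
\<close>

datatype functional =
    Zero
  | Succ
  | First
  | Second
  | Oracle
  | Tuple functional functional
  | Comp functional functional
  | PrimRec functional functional
  | Search functional

primrec run :: "functional \<Rightarrow> nat set \<Rightarrow> nat \<rightharpoonup> nat" where
  "run Zero X x = Some 0"
| "run Succ X x = Some (Suc x)"
| "run First X x = Some (fst (prod_decode x))"
| "run Second X x = Some (snd (prod_decode x))"
| "run Oracle X x = Some (if x \<in> X then 1 else 0)"
| "run (Tuple p q) X x =
     Option.bind (run p X x) (\<lambda>a. Option.bind (run q X x) (\<lambda>b. Some (prod_encode (a, b))))"
| "run (Comp p q) X x = Option.bind (run q X x) (run p X)"
| "run (PrimRec p q) X x =
     (case prod_decode x of (a, n) \<Rightarrow>
        rec_nat (run p X a)
          (\<lambda>k r. Option.bind r (\<lambda>v. run q X (prod_encode (a, prod_encode (k, v))))) n)"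
| "run (Search p) X x =
     (let found = (\<lambda>n. run p X (prod_encode (x, n)) = Some 0 \<and>
                       (\<forall>k<n. run p X (prod_encode (x, k)) \<noteq> None))
      in if \<exists>n. found n then Some (LEAST n. found n) else None)"

primrec code :: "functional \<Rightarrow> nat" where
  "code Zero = prod_encode (0, 0)"
| "code Succ = prod_encode (1, 0)"
| "code First = prod_encode (2, 0)"
| "code Second = prod_encode (3, 0)"
| "code Oracle = prod_encode (4, 0)"
| "code (Tuple p q) = prod_encode (5, prod_encode (code p, code q))"
| "code (Comp p q) = prod_encode (6, prod_encode (code p, code q))"
| "code (PrimRec p q) = prod_encode (7, prod_encode (code p, code q))"
| "code (Search p) = prod_encode (8, code p)"

lemma inj_code: "inj code"
proof (rule injI)
  fix p q show "code p = code q \<Longrightarrow> p = q"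
    by (induction p arbitrary: q; case_tac q; simp)
qed

definition jump :: "nat set \<Rightarrow> nat set" where
  "jump X = {code p | p. code p \<in> dom (run p X)}"

definition computes :: "(nat \<rightharpoonup> nat) \<Rightarrow> nat set \<Rightarrow> bool" where
  "computes f C \<longleftrightarrow> (\<forall>n. f n = Some (if n \<in> C then 1 else 0))"

text \<open>Computing a pair of reals means computing its join.\<close>

definition join :: "nat set \<Rightarrow> nat set \<Rightarrow> nat set" where
  "join A B = {2 * n | n. n \<in> A} \<union> {2 * n + 1 | n. n \<in> B}"

section \<open>Generic reducibility\<close>

definition density_1 :: "nat set \<Rightarrow> bool" where
  "density_1 A \<longleftrightarrow> (\<lambda>n. real (card (A \<inter> {..<n})) / real n) \<longlonglongrightarrow> 1"

definition triple :: "nat \<Rightarrow> nat \<Rightarrow> nat \<Rightarrow> nat" where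
  "triple n x l = prod_encode (n, prod_encode (x, l))"

text \<open>
  Only the values \<open>0\<close> and \<open>1\<close> may occur in a partial oracle; otherwise triples carrying no
  information about \<open>C\<close> would contribute to the domain. Every natural is a triple.
\<close>

definition partial_oracle :: "nat set \<Rightarrow> nat set \<Rightarrow> bool" where
  "partial_oracle P C \<longleftrightarrow>
     (\<forall>n x l. triple n x l \<in> P \<longrightarrow> x \<in> {0, 1}) \<and>
     (\<forall>n l. triple n 0 l \<in> P \<longrightarrow> n \<notin> C) \<and>
     (\<forall>n l. triple n 1 l \<in> P \<longrightarrow> n \<in> C)"

definition oracle_dom :: "nat set \<Rightarrow> nat set" where
  "oracle_dom P = {n. \<exists>x l. triple n x l \<in> P}"

definition generic_oracle :: "nat set \<Rightarrow> nat set \<Rightarrow> bool" where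
  "generic_oracle P C \<longleftrightarrow> partial_oracle P C \<and> density_1 (oracle_dom P)"

definition generic_computation :: "(nat \<rightharpoonup> nat) \<Rightarrow> nat set \<Rightarrow> bool" where
  "generic_computation f D \<longleftrightarrow>
     density_1 (dom f) \<and> ran f \<subseteq> {0, 1} \<and>
     (\<forall>n\<in>dom f. f n = Some (if n \<in> D then 1 else 0))"

definition generic_ge :: "nat set \<Rightarrow> nat set \<Rightarrow> bool" (infix "\<ge>\<^sub>g" 50) where
  "C \<ge>\<^sub>g D \<longleftrightarrow> (\<exists>p. \<forall>P. generic_oracle P C \<longrightarrow> generic_computation (run p P) D)"

section \<open>Trees\<close>

definition is_tree :: "nat list set \<Rightarrow> bool" where
  "is_tree T \<longleftrightarrow> (\<forall>s t. s @ t \<in> T \<longrightarrow> s \<in> T)"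

definition well_founded_tree :: "nat list set \<Rightarrow> bool" where
  "well_founded_tree T \<longleftrightarrow> \<not> (\<exists>f :: nat \<Rightarrow> nat. \<forall>n. map f [0..<n] \<in> T)"

definition tree_code :: "nat list set \<Rightarrow> nat set" where
  "tree_code T = list_encode ` T"

section \<open>Boldface projective sets and Borel reductions\<close>

definition baire_space :: "(nat \<Rightarrow> nat) topology" where
  "baire_space = product_topology (\<lambda>_. discrete_topology UNIV) UNIV"

definition cantor_space :: "nat set topology" where
  "cantor_space =
     pullback_topology UNIV (\<lambda>A n. n \<in> A)
       (product_topology (\<lambda>_. discrete_topology (UNIV :: bool set)) UNIV)"

definition Sigma11 :: "'a topology \<Rightarrow> 'a set \<Rightarrow> bool" where
  "Sigma11 X A \<longleftrightarrow> (\<exists>F. closedin (prod_topology X baire_space) F \<and> A = fst ` F)"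

definition Pi11 :: "'a topology \<Rightarrow> 'a set \<Rightarrow> bool" where
  "Pi11 X A \<longleftrightarrow> A \<subseteq> topspace X \<and> Sigma11 X (topspace X - A)"

definition borel_of :: "'a topology \<Rightarrow> 'a measure" where
  "borel_of X = sigma (topspace X) {U. openin X U}"

definition polish_topology :: "'a topology \<Rightarrow> bool" where
  "polish_topology X \<longleftrightarrow> completely_metrizable_space X \<and> second_countable X"

definition borel_reduces :: "'a topology \<Rightarrow> 'a set \<Rightarrow> 'b topology \<Rightarrow> 'b set \<Rightarrow> bool" where
  "borel_reduces Y P X A \<longleftrightarrow>
     (\<exists>f \<in> measurable (borel_of Y) (borel_of X). \<forall>y \<in> topspace Y. y \<in> P \<longleftrightarrow> f y \<in> A)"

text \<open>
  A Polish space has at most continuum many points, so up to homeomorphism the topologies \<open>Y\<close> on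
  \<^typ>\<open>nat set\<close> below (whose carrier may be a proper subset of the type) are all Polish spaces.
\<close>

definition Pi11_complete :: "'a topology \<Rightarrow> 'a set \<Rightarrow> bool" where
  "Pi11_complete X A \<longleftrightarrow>
     Pi11 X A \<and>
     (\<forall>(Y :: nat set topology) P. polish_topology Y \<and> Pi11 Y P \<longrightarrow> borel_reduces Y P X A)"

end

theory Submission
  imports Defs
begin

text \<open>
  The coding uses infinitely many columns of positive density, so that a generic oracle answers
  infinitely many questions in each of them. Let \<open>G\<close> be sufficiently generic relative to a tree \<open>T\<close>,
  but computable from the jump of \<open>T\<close>. Replace \<open>T\<close> by its upward closure under the pointwise
  order, and attach to each of its nodes \<open>u\<close>, for each \<open>n\<close>, a bit of \<open>G\<close>; nodes off the tree get the
  bit \<open>0\<close>. The \<open>n\<close>th column of \<open>B\<close> repeats the bit of the root, and \<open>A\<close> has, for each pair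
  \<open>(n, u)\<close>, a column that lists the sums modulo 2 of the bits of \<open>u\<close> and of its \<open>k\<close>th children, besides
  columns that tell which nodes are on the tree.

  If \<open>T\<close> is well-founded, then so is its upward closure. Starting from the root and following
  whichever children a generic oracle for \<open>A\<close> talks about, one leaves the tree after finitely many
  steps, and then the sum of the labels seen on the way is the bit of the root.

  If \<open>z\<close> is a path of \<open>T\<close>, consider the oracle that hides, for each node \<open>u\<close>, the children \<open>k < z |u|\<close>.
  Only finitely much of each column is hidden, so this oracle is generic. But no visible edge joins
  the set of nodes pointwise above \<open>z\<close> to its complement, so flipping all bits in this set changes
  the root but nothing visible. As \<open>G\<close> is generic, no functional can compute \<open>B\<close> from all these oracles.

  For the completeness part, a coanalytic subset of a metrizable space is reduced to the
  well-foundedness of the trees of attempts to find a point of a closed set above a given point.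
\<close>

section \<open>Computable functions\<close>

abbreviation pair :: "nat \<Rightarrow> nat \<Rightarrow> nat" where
  "pair a b \<equiv> prod_encode (a, b)"

definition pfst :: "nat \<Rightarrow> nat" where
  "pfst z = fst (prod_decode z)"

definition psnd :: "nat \<Rightarrow> nat" where
  "psnd z = snd (prod_decode z)"

lemma pfst_pair [simp]: "pfst (pair a b) = a"
  and psnd_pair [simp]: "psnd (pair a b) = b"
  and pair_pfst_psnd [simp]: "pair (pfst z) (psnd z) = z"
  by (simp_all add: pfst_def psnd_def)

text \<open>
  The oracle is \<open>Or i\<close> for an index \<open>i \<in> I\<close>: this covers computations from \<open>X\<close> itself, from the
  jump of \<open>X\<close>, and from the generic oracles of a fixed real.
\<close>

definition computable :: "'i set \<Rightarrow> ('i \<Rightarrow> nat set) \<Rightarrow> ('i \<Rightarrow> nat \<Rightarrow> nat) \<Rightarrow> bool" where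
  "computable I Or F \<longleftrightarrow> (\<exists>p. \<forall>i\<in>I. \<forall>x. run p (Or i) x = Some (F i x))"

definition decidable :: "'i set \<Rightarrow> ('i \<Rightarrow> nat set) \<Rightarrow> ('i \<Rightarrow> nat \<Rightarrow> bool) \<Rightarrow> bool" where
  "decidable I Or Q \<longleftrightarrow> computable I Or (\<lambda>i x. of_bool (Q i x))"

lemma computableE:
  assumes "computable I Or F"
  obtains p where "\<And>i x. i \<in> I \<Longrightarrow> run p (Or i) x = Some (F i x)"
  using assms unfolding computable_def by blast

lemma computable_cong:
  assumes "\<And>i x. i \<in> I \<Longrightarrow> F i x = F' i x"
  shows "computable I Or F \<longleftrightarrow> computable I Or F'"
  unfolding computable_def using assms by simp

lemma decidable_cong:
  assumes "\<And>i x. i \<in> I \<Longrightarrow> Q i x \<longleftrightarrow> Q' i x"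
  shows "decidable I Or Q \<longleftrightarrow> decidable I Or Q'"
  unfolding decidable_def by (rule computable_cong) (simp add: assms)

primrec const_program :: "nat \<Rightarrow> functional" where
  "const_program 0 = Zero"
| "const_program (Suc c) = Comp Succ (const_program c)"

lemma run_const_program [simp]: "run (const_program c) X x = Some c"
  by (induction c) auto

lemma computable_id: "computable I Or (\<lambda>i x. x)"
  unfolding computable_def by (rule exI[of _ "Tuple First Second"]) simp

lemma computable_const: "computable I Or (\<lambda>i x. c)"
  unfolding computable_def by (rule exI[of _ "const_program c"]) simp

lemma computable_compose:
  assumes "computable I Or F" "computable I Or f"
  shows "computable I Or (\<lambda>i x. F i (f i x))"
proof -
  obtain p where "\<And>i x. i \<in> I \<Longrightarrow> run p (Or i) x = Some (F i x)"
    using assms(1) by (rule computableE) blast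
  moreover obtain q where "\<And>i x. i \<in> I \<Longrightarrow> run q (Or i) x = Some (f i x)"
    using assms(2) by (rule computableE) blast
  ultimately show ?thesis unfolding computable_def by (intro exI[of _ "Comp p q"]) simp
qed

lemma decidable_compose:
  assumes "decidable I Or Q" "computable I Or f"
  shows "decidable I Or (\<lambda>i x. Q i (f i x))"
  using computable_compose assms unfolding decidable_def .

lemma computable_pfst: "computable I Or f \<Longrightarrow> computable I Or (\<lambda>i x. pfst (f i x))"
proof (rule computable_compose[of _ _ "\<lambda>i. pfst"])
  show "computable I Or (\<lambda>i. pfst)"
    unfolding computable_def by (rule exI[of _ First]) (simp add: pfst_def)
qed

lemma computable_psnd: "computable I Or f \<Longrightarrow> computable I Or (\<lambda>i x. psnd (f i x))"
proof (rule computable_compose[of _ _ "\<lambda>i. psnd"])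
  show "computable I Or (\<lambda>i. psnd)"
    unfolding computable_def by (rule exI[of _ Second]) (simp add: psnd_def)
qed

lemma computable_Suc: "computable I Or f \<Longrightarrow> computable I Or (\<lambda>i x. Suc (f i x))"
proof (rule computable_compose[of _ _ "\<lambda>i. Suc"])
  show "computable I Or (\<lambda>i. Suc)"
    unfolding computable_def by (rule exI[of _ Succ]) simp
qed

lemma decidable_oracle: "computable I Or f \<Longrightarrow> decidable I Or (\<lambda>i x. f i x \<in> Or i)"
proof (rule decidable_compose[of _ _ "\<lambda>i x. x \<in> Or i"])
  show "decidable I Or (\<lambda>i x. x \<in> Or i)"
    unfolding computable_def decidable_def by (rule exI[of _ Oracle]) simp
qed

lemma computable_pair:
  assumes "computable I Or f" "computable I Or g"
  shows "computable I Or (\<lambda>i x. pair (f i x) (g i x))"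
proof -
  obtain p where "\<And>i x. i \<in> I \<Longrightarrow> run p (Or i) x = Some (f i x)"
    using assms(1) by (rule computableE) blast
  moreover obtain q where "\<And>i x. i \<in> I \<Longrightarrow> run q (Or i) x = Some (g i x)"
    using assms(2) by (rule computableE) blast
  ultimately show ?thesis unfolding computable_def by (intro exI[of _ "Tuple p q"]) simp
qed

text \<open>The whole input serves as the parameter of \<open>PrimRec\<close>, so that the base, the
  step and the number of steps may all depend on it.\<close>

lemma computable_rec_nat:
  assumes "computable I Or g" "computable I Or (\<lambda>i z. h i (pfst z) (pfst (psnd z)) (psnd (psnd z)))"
    and "computable I Or n"
  shows "computable I Or (\<lambda>i x. rec_nat (g i x) (h i x) (n i x))"
proof -
  obtain p where p: "\<And>i x. i \<in> I \<Longrightarrow> run p (Or i) x = Some (g i x)"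
    using assms(1) by (rule computableE) blast
  obtain q where
    q: "\<And>i z. i \<in> I \<Longrightarrow> run q (Or i) z = Some (h i (pfst z) (pfst (psnd z)) (psnd (psnd z)))"
    using assms(2) by (rule computableE) blast
  obtain r where r: "\<And>i x. i \<in> I \<Longrightarrow> run r (Or i) x = Some (n i x)"
    using assms(3) by (rule computableE) blast
  have rec: "rec_nat (run p (Or i) x)
        (\<lambda>k r. Option.bind r (\<lambda>v. run q (Or i) (pair x (pair k v)))) m = Some (rec_nat (g i x) (h i x) m)"
    if "i \<in> I" for i x m
    using that by (induction m) (simp_all add: p q)
  show ?thesis unfolding computable_def
    by (rule exI[of _ "Comp (PrimRec p q) (Tuple (Tuple First Second) r)"])
      (simp add: r rec)
qed

lemma computable_if:
  assumes "decidable I Or Q" "computable I Or f" "computable I Or g"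
  shows "computable I Or (\<lambda>i x. if Q i x then f i x else g i x)"
proof -
  \<comment> \<open>A recursion of length \<open>0\<close> or \<open>1\<close> selects the
    branch.\<close>
  have "computable I Or (\<lambda>i x. rec_nat (g i x) (\<lambda>k r. f i x) (of_bool (Q i x)))"
    using assms unfolding decidable_def
    by (intro computable_rec_nat computable_compose[OF assms(2)] computable_pfst computable_id)
  then show ?thesis
    by (rule computable_cong[THEN iffD1, rotated]) simp
qed

lemma decidable_True: "decidable I Or (\<lambda>i x. True)"
  and decidable_False: "decidable I Or (\<lambda>i x. False)"
  unfolding decidable_def by (simp_all add: computable_const)

lemma decidable_if:
  assumes "decidable I Or Q" "decidable I Or R" "decidable I Or S"
  shows "decidable I Or (\<lambda>i x. if Q i x then R i x else S i x)"
  using computable_if[OF assms(1) assms(2,3)[unfolded decidable_def]]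
  unfolding decidable_def by (rule computable_cong[THEN iffD1, rotated]) simp

lemma decidable_not:
  assumes "decidable I Or Q"
  shows "decidable I Or (\<lambda>i x. \<not> Q i x)"
  using decidable_if[OF assms decidable_False decidable_True]
  by (rule decidable_cong[THEN iffD1, rotated]) simp

lemma decidable_conj:
  assumes "decidable I Or Q" "decidable I Or R"
  shows "decidable I Or (\<lambda>i x. Q i x \<and> R i x)"
  using decidable_if[OF assms decidable_False]
  by (rule decidable_cong[THEN iffD1, rotated]) simp

lemma decidable_disj:
  assumes "decidable I Or Q" "decidable I Or R"
  shows "decidable I Or (\<lambda>i x. Q i x \<or> R i x)"
  using decidable_if[OF assms(1) decidable_True assms(2)]
  by (rule decidable_cong[THEN iffD1, rotated]) simp

lemma decidable_imp:
  assumes "decidable I Or Q" "decidable I Or R"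
  shows "decidable I Or (\<lambda>i x. Q i x \<longrightarrow> R i x)"
  using decidable_if[OF assms decidable_True]
  by (rule decidable_cong[THEN iffD1, rotated]) simp

lemma decidable_iff:
  assumes "decidable I Or Q" "decidable I Or R"
  shows "decidable I Or (\<lambda>i x. Q i x \<longleftrightarrow> R i x)"
  using decidable_if[OF assms decidable_not[OF assms(2)]]
  by (rule decidable_cong[THEN iffD1, rotated]) auto

section \<open>Arithmetic and comparisons\<close>

lemma decidable_eq_0: "computable I Or f \<Longrightarrow> decidable I Or (\<lambda>i x. f i x = 0)"
proof -
  assume "computable I Or f"
  then have "computable I Or (\<lambda>i x. rec_nat 1 (\<lambda>k r. 0) (f i x))"
    by (intro computable_rec_nat computable_const)
  moreover have "rec_nat 1 (\<lambda>k r. 0) n = (of_bool (n = 0) :: nat)" for n :: nat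
    by (cases n) simp_all
  ultimately show ?thesis by (simp only: decidable_def)
qed

lemma computable_pred: "computable I Or f \<Longrightarrow> computable I Or (\<lambda>i x. f i x - 1)"
proof -
  assume "computable I Or f"
  then have "computable I Or (\<lambda>i x. rec_nat 0 (\<lambda>k r. k) (f i x))"
    by (intro computable_rec_nat computable_const computable_pfst computable_psnd computable_id)
  moreover have "rec_nat 0 (\<lambda>k r. k) n = n - 1" for n :: nat
    by (cases n) simp_all
  ultimately show ?thesis by (simp only:)
qed

lemma computable_add:
  assumes "computable I Or f" "computable I Or g"
  shows "computable I Or (\<lambda>i x. f i x + g i x)"
proof -
  have "computable I Or (\<lambda>i x. rec_nat (f i x) (\<lambda>k r. Suc r) (g i x))"
    using assms by (intro computable_rec_nat computable_Suc computable_psnd computable_id)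
  moreover have "rec_nat m (\<lambda>k r. Suc r) n = m + n" for m n :: nat
    by (induction n) simp_all
  ultimately show ?thesis by (simp only:)
qed

lemma computable_diff:
  assumes "computable I Or f" "computable I Or g"
  shows "computable I Or (\<lambda>i x. f i x - g i x)"
proof -
  have "computable I Or (\<lambda>i x. rec_nat (f i x) (\<lambda>k r. r - 1) (g i x))"
    using assms by (intro computable_rec_nat computable_pred computable_psnd computable_id)
  moreover have "rec_nat m (\<lambda>k r. r - 1) n = m - n" for m n :: nat
    by (induction n) simp_all
  ultimately show ?thesis by (simp only:)
qed

lemma computable_mult:
  assumes "computable I Or f" "computable I Or g"
  shows "computable I Or (\<lambda>i x. f i x * g i x)"
proof -
  have "computable I Or (\<lambda>i x. rec_nat 0 (\<lambda>k r. r + f i x) (g i x))"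
    by (intro computable_rec_nat computable_const computable_add computable_psnd assms
        computable_compose[OF assms(1)] computable_pfst computable_id)
  moreover have "rec_nat 0 (\<lambda>k r. r + m) n = m * n" for m n :: nat
    by (induction n) simp_all
  ultimately show ?thesis by (simp only:)
qed

lemma computable_power:
  assumes "computable I Or f" "computable I Or g"
  shows "computable I Or (\<lambda>i x. f i x ^ g i x)"
proof -
  have "computable I Or (\<lambda>i x. rec_nat 1 (\<lambda>k r. r * f i x) (g i x))"
    by (intro computable_rec_nat computable_const computable_mult computable_psnd assms
        computable_compose[OF assms(1)] computable_pfst computable_id)
  moreover have "rec_nat 1 (\<lambda>k r. r * m) n = m ^ n" for m n :: nat
    by (induction n) simp_all
  ultimately show ?thesis by (simp only:)
qed

lemma decidable_le:
  assumes "computable I Or f" "computable I Or g"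
  shows "decidable I Or (\<lambda>i x. f i x \<le> g i x)"
  using decidable_eq_0[OF computable_diff[OF assms]] by simp

lemma decidable_less:
  assumes "computable I Or f" "computable I Or g"
  shows "decidable I Or (\<lambda>i x. f i x < g i x)"
  using decidable_le[OF computable_Suc[OF assms(1)] assms(2)] by (simp add: Suc_le_eq)

lemma decidable_eq:
  assumes "computable I Or f" "computable I Or g"
  shows "decidable I Or (\<lambda>i x. f i x = g i x)"
  using decidable_conj[OF decidable_le[OF assms] decidable_le[OF assms(2,1)]]
  by (simp add: order_eq_iff)

section \<open>Bounded quantifiers, search and iteration\<close>

lemma decidable_bex:
  assumes "computable I Or n" "decidable I Or (\<lambda>i z. Q i (pfst z) (psnd z))"
  shows "decidable I Or (\<lambda>i x. \<exists>k<n i x. Q i x k)"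
proof -
  have "decidable I Or (\<lambda>i z. Q i (pfst z) (pfst (psnd z)))"
    using decidable_compose[OF assms(2), of "\<lambda>i z. pair (pfst z) (pfst (psnd z))"]
    by (simp add: computable_pair computable_pfst computable_psnd computable_id)
  then have "computable I Or (\<lambda>i x. rec_nat 0 (\<lambda>k r. if Q i x k then 1 else r) (n i x))"
    using assms(1) by (intro computable_rec_nat computable_const computable_if computable_psnd computable_id)
  moreover have "rec_nat 0 (\<lambda>k r. if R k then 1 else r) m = (of_bool (\<exists>k<m. R k) :: nat)" for R and m :: nat
    by (induction m) (auto simp: less_Suc_eq)
  ultimately show ?thesis by (simp only: decidable_def)
qed

lemma decidable_ball:
  assumes "computable I Or n" "decidable I Or (\<lambda>i z. Q i (pfst z) (psnd z))"
  shows "decidable I Or (\<lambda>i x. \<forall>k<n i x. Q i x k)"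
  using decidable_not[OF decidable_bex[OF assms(1) decidable_not[OF assms(2)]]] by simp

lemma decidable_bex_le:
  assumes "computable I Or n" "decidable I Or (\<lambda>i z. Q i (pfst z) (psnd z))"
  shows "decidable I Or (\<lambda>i x. \<exists>k\<le>n i x. Q i x k)"
  using decidable_bex[OF computable_Suc[OF assms(1)] assms(2)] by (simp add: less_Suc_eq_le)

lemma computable_of_bool:
  "decidable I Or Q \<Longrightarrow> computable I Or (\<lambda>i x. of_bool (Q i x))"
  by (simp add: decidable_def)

lemma computable_Least:
  assumes "decidable I Or (\<lambda>i z. Q i (pfst z) (psnd z))" "\<And>i x. i \<in> I \<Longrightarrow> \<exists>n. Q i x n"
  shows "computable I Or (\<lambda>i x. LEAST n. Q i x n)"
proof -
  \<comment> \<open>\<open>Search\<close> looks for the value \<open>0\<close>, hence the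
    negation.\<close>
  have "computable I Or (\<lambda>i z. of_bool (\<not> Q i (pfst z) (psnd z)))"
    by (intro computable_of_bool decidable_not assms(1))
  then obtain p where p: "\<And>i z. i \<in> I \<Longrightarrow> run p (Or i) z = Some (of_bool (\<not> Q i (pfst z) (psnd z)))"
    by (rule computableE) blast
  show ?thesis unfolding computable_def
  proof (intro exI[of _ "Search p"] ballI allI)
    fix i x assume "i \<in> I"
    then show "run (Search p) (Or i) x = Some (LEAST n. Q i x n)"
      using assms(2)[of i x] by (simp add: p)
  qed
qed

lemma computable_funpow:
  assumes "computable I Or h" "computable I Or n" "computable I Or a"
  shows "computable I Or (\<lambda>i x. (h i ^^ n i x) (a i x))"
proof -
  have "computable I Or (\<lambda>i x. rec_nat (a i x) (\<lambda>k r. h i r) (n i x))"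
    by (intro computable_rec_nat assms computable_compose[OF assms(1)] computable_psnd computable_id)
  moreover have "rec_nat b (\<lambda>k r. g r) m = (g ^^ m) b" for g :: "nat \<Rightarrow> nat" and b m
    by (induction m) simp_all
  ultimately show ?thesis by (simp only:)
qed

lemmas computable_intros =
  computable_id computable_const decidable_True decidable_False
  computable_pfst computable_psnd computable_Suc computable_pair computable_if
  computable_pred computable_add computable_diff computable_mult computable_power
  computable_of_bool decidable_oracle decidable_not decidable_conj decidable_disj decidable_imp
  decidable_iff decidable_le decidable_less decidable_eq decidable_bex decidable_ball decidable_bex_le

section \<open>Computing from the jump\<close>

primrec subst_oracle :: "functional \<Rightarrow> functional \<Rightarrow> functional" where
  "subst_oracle u Zero = Zero"
| "subst_oracle u Succ = Succ"
| "subst_oracle u First = First"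
| "subst_oracle u Second = Second"
| "subst_oracle u Oracle = u"
| "subst_oracle u (Tuple p q) = Tuple (subst_oracle u p) (subst_oracle u q)"
| "subst_oracle u (Comp p q) = Comp (subst_oracle u p) (subst_oracle u q)"
| "subst_oracle u (PrimRec p q) = PrimRec (subst_oracle u p) (subst_oracle u q)"
| "subst_oracle u (Search p) = Search (subst_oracle u p)"

lemma run_subst_oracle:
  assumes "\<And>x. run u Y x = Some (of_bool (x \<in> X))"
  shows "run (subst_oracle u p) Y = run p X"
  by (induction p) (rule ext, simp add: assms)+

text \<open>The program \<open>Comp (Search p) (const_program x)\<close> ignores its input and
  halts, on its own code in particular, just when some \<open>w\<close> exists. Its code is
  computable from \<open>x\<close>, so one query to the jump settles the question.\<close>

lemma decidable_jump_Ex: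
  assumes "decidable UNIV (\<lambda>X. X) (\<lambda>X z. Q X (pfst z) (psnd z))"
  shows "decidable UNIV jump (\<lambda>X x. \<exists>w. Q X x w)"
proof -
  have "computable UNIV (\<lambda>X. X) (\<lambda>X z. of_bool (\<not> Q X (pfst z) (psnd z)))"
    by (intro computable_of_bool decidable_not assms)
  then obtain p where p: "\<And>X z. run p X z = Some (of_bool (\<not> Q X (pfst z) (psnd z)))"
    by (rule computableE) blast
  let ?c = "\<lambda>x. rec_nat (code Zero) (\<lambda>k r. pair 6 (pair (code Succ) r)) x"
  have c: "?c x = code (const_program x)" for x
    by (induction x) simp_all
  have "(\<exists>w. Q X x w) \<longleftrightarrow> pair 6 (pair (code (Search p)) (?c x)) \<in> jump X" for X x
  proof -
    have *: "pair 6 (pair (code (Search p)) (?c x)) = code (Comp (Search p) (const_program x))"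
      by (simp only: c code.simps(7))
    have **: "code q \<in> jump X \<longleftrightarrow> run q X (code q) \<noteq> None" for q
      unfolding jump_def using inj_code by (auto simp: inj_eq)
    show ?thesis
      unfolding * ** by (simp add: p Let_def)
  qed
  moreover have "decidable UNIV jump (\<lambda>X x. pair 6 (pair (code (Search p)) (?c x)) \<in> jump X)"
    by (intro computable_intros computable_rec_nat)
  ultimately show ?thesis by (simp only:)
qed

text \<open>A vacuous quantifier in the previous lemma shows that one program decides every
  \<open>X\<close> from its jump. Substituting it for the oracle turns computations from
  \<open>X\<close> into computations from \<open>jump X\<close>.\<close>

lemma computable_jump:
  assumes "computable UNIV (\<lambda>X. X) F"
  shows "computable UNIV jump F"
proof -
  have "decidable UNIV jump (\<lambda>X x. \<exists>w::nat. x \<in> X)"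
    by (intro decidable_jump_Ex computable_intros)
  then obtain u where u: "\<And>X x. run u (jump X) x = Some (of_bool (x \<in> X))"
    unfolding decidable_def by (rule computableE) (simp, blast)
  obtain p where p: "\<And>X x. run p X x = Some (F X x)"
    using assms by (rule computableE) blast
  show ?thesis
    unfolding computable_def
    by (intro exI[of _ "subst_oracle u p"]) (simp add: run_subst_oracle[OF u] p)
qed

lemma decidable_jump:
  "decidable UNIV (\<lambda>X. X) Q \<Longrightarrow> decidable UNIV jump Q"
  unfolding decidable_def by (rule computable_jump)

section \<open>Codes of lists\<close>

text \<open>\<open>list_encode\<close> sends the empty list to \<open>0\<close> and other lists to
  the successor of a pair. Head and tail of the code \<open>0\<close> are again \<open>0\<close>, so
  iterating \<open>ctl\<close> past the end of a list is harmless.\<close>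

definition chd :: "nat \<Rightarrow> nat" where
  "chd c = pfst (c - 1)"

definition ctl :: "nat \<Rightarrow> nat" where
  "ctl c = psnd (c - 1)"

lemma chd_Suc [simp]: "chd (Suc z) = pfst z"
  and ctl_Suc [simp]: "ctl (Suc z) = psnd z"
  by (simp_all add: chd_def ctl_def)

lemma psnd_0 [simp]: "psnd 0 = 0"
  using psnd_pair[of 0 0] by (simp add: prod_encode_def del: psnd_pair)

lemma ctl_list_encode [simp]: "ctl (list_encode xs) = list_encode (tl xs)"
  by (cases xs) (simp_all add: ctl_def)

lemma ctl_funpow_list_encode [simp]: "(ctl ^^ j) (list_encode xs) = list_encode (drop j xs)"
  by (induction j) (simp_all add: tl_drop drop_Suc)

lemma list_encode_eq_0 [simp]: "list_encode xs = 0 \<longleftrightarrow> xs = []"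
  by (cases xs) simp_all

lemma length_le_list_encode: "length xs \<le> list_encode xs"
proof (induction xs)
  case (Cons x xs)
  then show ?case using le_prod_encode_2[of "list_encode xs" x] by simp
qed simp

lemma mem_less_list_encode: "x \<in> set xs \<Longrightarrow> x < list_encode xs"
proof (induction xs)
  case (Cons a xs)
  then show ?case
    using le_prod_encode_2[of "list_encode xs" a] le_prod_encode_1[of a "list_encode xs"] by auto
qed simp

lemma computable_chd: "computable I Or f \<Longrightarrow> computable I Or (\<lambda>i x. chd (f i x))"
  unfolding chd_def by (intro computable_intros)

lemma computable_ctl: "computable I Or f \<Longrightarrow> computable I Or (\<lambda>i x. ctl (f i x))"
  unfolding ctl_def by (intro computable_intros)

lemma computable_ctl_funpow:
  assumes "computable I Or f" "computable I Or n"
  shows "computable I Or (\<lambda>i x. (ctl ^^ n i x) (f i x))"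
  by (intro computable_funpow[where h="\<lambda>_. ctl"] computable_ctl computable_id assms)

text \<open>A list is no longer than its code, so the search for a position is bounded by
  \<open>c\<close>.\<close>

lemma mem_list_decode_iff:
  "x \<in> set (list_decode c) \<longleftrightarrow> (\<exists>j<c. (ctl ^^ j) c \<noteq> 0 \<and> chd ((ctl ^^ j) c) = x)"
proof -
  obtain xs where c: "c = list_encode xs" by (metis list_decode_inverse)
  show ?thesis
  proof
    assume "x \<in> set (list_decode c)"
    then obtain j where "j < length xs" "xs ! j = x"
      by (auto simp: c in_set_conv_nth)
    then show "\<exists>j<c. (ctl ^^ j) c \<noteq> 0 \<and> chd ((ctl ^^ j) c) = x"
      using length_le_list_encode[of xs] Cons_nth_drop_Suc[of j xs, symmetric]
      by (intro exI[of _ j]) (auto simp: c)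
  next
    assume "\<exists>j<c. (ctl ^^ j) c \<noteq> 0 \<and> chd ((ctl ^^ j) c) = x"
    then obtain j where "drop j xs \<noteq> []" "chd (list_encode (drop j xs)) = x"
      by (auto simp: c)
    then have "x \<in> set (drop j xs)" by (cases "drop j xs") auto
    then show "x \<in> set (list_decode c)" by (auto simp: c dest: in_set_dropD)
  qed
qed

lemma decidable_mem:
  assumes "computable I Or f" "computable I Or g"
  shows "decidable I Or (\<lambda>i x. f i x \<in> set (list_decode (g i x)))"
proof -
  have "decidable I Or (\<lambda>i z. pfst z \<in> set (list_decode (psnd z)))"
    unfolding mem_list_decode_iff by (intro computable_intros computable_chd computable_ctl_funpow)
  from decidable_compose[OF this computable_pair[OF assms]] show ?thesis by simp
qed

text \<open>The state holds the part already reversed and the part still to be read. Once the latter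
  is empty nothing changes, so a list may be iterated over as often as its code says, which is at
  least its length.\<close>

definition crev_step :: "nat \<Rightarrow> nat" where
  "crev_step z = (if psnd z = 0 then z else pair (Suc (pair (chd (psnd z)) (pfst z))) (ctl (psnd z)))"

definition crev :: "nat \<Rightarrow> nat" where
  "crev c = pfst ((crev_step ^^ c) (pair 0 c))"

lemma crev_list_encode: "crev (list_encode xs) = list_encode (rev xs)"
proof -
  have "length xs \<le> n \<Longrightarrow>
      (crev_step ^^ n) (pair (list_encode ys) (list_encode xs)) = pair (list_encode (rev xs @ ys)) 0" for n ys
  proof (induction xs arbitrary: n ys)
    case Nil
    show ?case by (induction n) (simp_all add: crev_step_def)
  next
    case (Cons x xs)
    then obtain m where m: "n = Suc m" "length xs \<le> m" by (cases n) auto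
    have "crev_step (pair (list_encode ys) (list_encode (x # xs)))
        = pair (list_encode (x # ys)) (list_encode xs)"
      by (simp add: crev_step_def)
    then show ?case using Cons.IH[of m "x # ys"] m
      by (simp add: funpow_swap1 del: list_encode.simps)
  qed
  from this[of "list_encode xs" "[]"] show ?thesis
    by (simp add: crev_def length_le_list_encode)
qed

lemma computable_crev:
  assumes "computable I Or f"
  shows "computable I Or (\<lambda>i x. crev (f i x))"
proof -
  have "computable I Or (\<lambda>i. crev_step)"
    unfolding crev_step_def by (intro computable_intros computable_chd computable_ctl)
  then show ?thesis unfolding crev_def
    by (intro computable_pfst computable_funpow computable_pair computable_const assms)
qed

section \<open>Derivations\<close>

text \<open>
  A claim \<open>\<langle>c, x, y\<rangle>\<close> says that the functional with code \<open>c\<close> maps \<open>x\<close> to \<open>y\<close>; \<open>Oa\<close> lists the admissible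
  answers to oracle queries. A derivation is a list of claims each of which follows from later ones.
\<close>

abbreviation claim :: "nat \<Rightarrow> nat \<Rightarrow> nat \<Rightarrow> nat" where
  "claim c x y \<equiv> pair c (pair x y)"

definition step_ok :: "(nat \<Rightarrow> nat \<Rightarrow> bool) \<Rightarrow> nat set \<Rightarrow> nat \<Rightarrow> nat \<Rightarrow> nat \<Rightarrow> bool" where
  "step_ok Oa S c x y \<longleftrightarrow>
     pfst c = 0 \<and> psnd c = 0 \<and> y = 0 \<or>
     pfst c = 1 \<and> psnd c = 0 \<and> y = Suc x \<or>
     pfst c = 2 \<and> psnd c = 0 \<and> y = pfst x \<or>
     pfst c = 3 \<and> psnd c = 0 \<and> y = psnd x \<or>
     pfst c = 4 \<and> psnd c = 0 \<and> Oa x y \<or>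
     pfst c = 5 \<and> claim (pfst (psnd c)) x (pfst y) \<in> S \<and> claim (psnd (psnd c)) x (psnd y) \<in> S \<or>
     pfst c = 6 \<and> (\<exists>v. claim (psnd (psnd c)) x v \<in> S \<and> claim (pfst (psnd c)) v y \<in> S) \<or>
     pfst c = 7 \<and> psnd x = 0 \<and> claim (pfst (psnd c)) (pfst x) y \<in> S \<or>
     pfst c = 7 \<and> psnd x \<noteq> 0 \<and> (\<exists>v. claim c (pair (pfst x) (psnd x - 1)) v \<in> S \<and>
        claim (psnd (psnd c)) (pair (pfst x) (pair (psnd x - 1) v)) y \<in> S) \<or>
     pfst c = 8 \<and> claim (psnd c) (pair x y) 0 \<in> S \<and>
        (\<forall>k<y. \<exists>v. v \<noteq> 0 \<and> claim (psnd c) (pair x k) v \<in> S)"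

primrec derivation :: "(nat \<Rightarrow> nat \<Rightarrow> bool) \<Rightarrow> nat list \<Rightarrow> bool" where
  "derivation Oa [] \<longleftrightarrow> True"
| "derivation Oa (a # ds) \<longleftrightarrow>
     derivation Oa ds \<and> step_ok Oa (set ds) (pfst a) (pfst (psnd a)) (psnd (psnd a))"

lemma step_ok_mono:
  assumes "step_ok Oa S c x y" "S \<subseteq> S'" "\<And>y. Oa x y \<Longrightarrow> Oa' x y"
  shows "step_ok Oa' S' c x y"
  using assms(1,3) subsetD[OF assms(2)] unfolding step_ok_def by (elim disj_forward) blast+

lemma derivation_append:
  "derivation Oa xs \<Longrightarrow> derivation Oa ys \<Longrightarrow> derivation Oa (xs @ ys)"
proof (induction xs)
  case (Cons a xs)
  then show ?case using step_ok_mono[of Oa "set xs" _ _ _ "set xs \<union> set ys"] by simp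
qed simp

lemma derivation_mono:
  assumes "derivation Oa ds" "\<And>c x y z. claim c x z \<in> set ds \<Longrightarrow> Oa x y \<Longrightarrow> Oa' x y"
  shows "derivation Oa' ds"
  using assms
proof (induction ds)
  case (Cons a ds)
  have "step_ok Oa' (set ds) (pfst a) (pfst (psnd a)) (psnd (psnd a))"
    using Cons.prems(1) Cons.prems(2)[of "pfst a" "pfst (psnd a)" "psnd (psnd a)"]
    by (auto intro: step_ok_mono)
  moreover have "derivation Oa' ds"
    using Cons.prems by (intro Cons.IH) auto
  ultimately show ?case by simp
qed simp

section \<open>Soundness and completeness of derivations\<close>

lemma run_PrimRec_Suc:
  "run (PrimRec p q) X (pair a (Suc n)) =
     Option.bind (run (PrimRec p q) X (pair a n)) (\<lambda>v. run q X (pair a (pair n v)))"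
  by simp

text \<open>Either the claim occurs in the tail, or it is the head and its premises lie in the tail,
  where the induction hypothesis makes them true.\<close>

lemma derivation_sound:
  assumes "derivation Oa ds" "\<And>x y. Oa x y \<Longrightarrow> y = of_bool (x \<in> X)"
    and "claim (code \<phi>) x y \<in> set ds"
  shows "run \<phi> X x = Some y"
  using assms(1,3)
proof (induction ds arbitrary: \<phi> x y)
  case (Cons a ds)
  have IH: "claim (code \<psi>) u v \<in> set ds \<Longrightarrow> run \<psi> X u = Some v" for \<psi> u v
    using Cons by simp
  show ?case
  proof (cases "claim (code \<phi>) x y \<in> set ds")
    case True
    then show ?thesis by (rule IH)
  next
    case False
    then have ok: "step_ok Oa (set ds) (code \<phi>) x y"
      using Cons.prems by auto
    show ?thesis
    proof (cases \<phi>)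
      case Oracle
      then show ?thesis using ok assms(2)[of x y] by (simp add: step_ok_def)
    next
      case (Tuple p q)
      then show ?thesis using ok IH[of p x "pfst y"] IH[of q x "psnd y"] by (simp add: step_ok_def)
    next
      case (Comp p q)
      then show ?thesis using ok IH by (auto simp add: step_ok_def)
    next
      case (PrimRec p q)
      obtain b n where x: "x = pair b n" by (metis pair_pfst_psnd)
      show ?thesis
      proof (cases n)
        case 0
        then show ?thesis using ok IH[of p b y] by (simp add: step_ok_def PrimRec x)
      next
        case (Suc m)
        then obtain v where "claim (code \<phi>) (pair b m) v \<in> set ds"
          "claim (code q) (pair b (pair m v)) y \<in> set ds"
          using ok by (auto simp add: step_ok_def PrimRec x)
        then have "run (PrimRec p q) X (pair b m) = Some v" "run q X (pair b (pair m v)) = Some y"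
          using IH PrimRec by blast+
        then show ?thesis
          unfolding x Suc PrimRec run_PrimRec_Suc by (simp del: run.simps)
      qed
    next
      case (Search p)
      then have "claim (code p) (pair x y) 0 \<in> set ds"
        and "\<forall>k<y. \<exists>v. v \<noteq> 0 \<and> claim (code p) (pair x k) v \<in> set ds"
        using ok by (simp_all add: step_ok_def)
      then have 0: "run p X (pair x y) = Some 0"
        and less: "\<And>k. k < y \<Longrightarrow> \<exists>v. v \<noteq> 0 \<and> run p X (pair x k) = Some v"
        using IH by blast+
      let ?found = "\<lambda>n. run p X (pair x n) = Some 0 \<and> (\<forall>k<n. run p X (pair x k) \<noteq> None)"
      have found: "?found y"
        using 0 less by auto
      moreover have "y \<le> n" if "?found n" for n
        using that less[of n] by (cases "n < y") auto
      ultimately have "(LEAST n. ?found n) = y"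
        by (rule Least_equality)
      moreover have "\<exists>n. ?found n"
        using found by blast
      ultimately show ?thesis
        unfolding Search run.simps Let_def by (simp only: if_True)
    qed (use ok in \<open>simp_all add: step_ok_def pfst_def psnd_def\<close>)
  qed
qed simp

definition derivable :: "(nat \<Rightarrow> nat \<Rightarrow> bool) \<Rightarrow> nat \<Rightarrow> bool" where
  "derivable Oa a \<longleftrightarrow> (\<exists>ds. derivation Oa ds \<and> a \<in> set ds)"

text \<open>Derivations of finitely many premises can be concatenated, and the new claim goes in
  front.\<close>

lemma derivable_step:
  assumes "finite S" "\<And>a. a \<in> S \<Longrightarrow> derivable Oa a" "step_ok Oa S c x y"
  shows "derivable Oa (claim c x y)"
proof -
  have "\<exists>ds. derivation Oa ds \<and> S \<subseteq> set ds"
    using assms(1,2)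
  proof (induction S rule: finite_induct)
    case empty
    show ?case by (rule exI[of _ "[]"]) simp
  next
    case (insert a S)
    then obtain ds where "derivation Oa ds" "S \<subseteq> set ds" by auto
    moreover obtain es where "derivation Oa es" "a \<in> set es"
      using insert.prems[of a] by (auto simp: derivable_def)
    ultimately show ?case
      by (intro exI[of _ "es @ ds"]) (auto intro: derivation_append)
  qed
  then obtain ds where "derivation Oa ds" "S \<subseteq> set ds" by blast
  then have "derivation Oa (claim c x y # ds)"
    using step_ok_mono[OF assms(3)] by simp
  then show ?thesis unfolding derivable_def by (intro exI[of _ "claim c x y # ds"]) simp
qed

text \<open>Every computation has only finitely many immediate premises. For \<open>Search\<close>
  these are the zero found at \<open>y\<close> and the nonzero values at all smaller
  arguments.\<close>

lemma derivable_complete: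
  assumes "run \<phi> X x = Some y"
  shows "derivable (\<lambda>x y. y = of_bool (x \<in> X)) (claim (code \<phi>) x y)"
  using assms
proof (induction \<phi> arbitrary: x y)
  case (Tuple p q)
  then obtain a b where "run p X x = Some a" "run q X x = Some b" "y = pair a b"
    by (auto split: Option.bind_splits)
  then show ?case using Tuple.IH
    by (intro derivable_step[where S="{claim (code p) x a, claim (code q) x b}"])
      (auto simp: step_ok_def)
next
  case (Comp p q)
  then obtain v where "run q X x = Some v" "run p X v = Some y"
    by (auto split: Option.bind_splits)
  then show ?case using Comp.IH
    by (intro derivable_step[where S="{claim (code q) x v, claim (code p) v y}"])
      (auto simp: step_ok_def)
next
  case (PrimRec p q)
  obtain a n where x: "x = pair a n" by (metis pair_pfst_psnd)
  have "run (PrimRec p q) X (pair a n) = Some y \<Longrightarrow>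
    derivable (\<lambda>x y. y = of_bool (x \<in> X)) (claim (code (PrimRec p q)) (pair a n) y)" for y
  proof (induction n arbitrary: y)
    case 0
    then show ?case using PrimRec.IH(1)[of a y]
      by (intro derivable_step[where S="{claim (code p) a y}"]) (auto simp: step_ok_def)
  next
    case (Suc n)
    then obtain v where v: "run (PrimRec p q) X (pair a n) = Some v"
      and y: "run q X (pair a (pair n v)) = Some y"
      unfolding run_PrimRec_Suc by (auto split: Option.bind_splits simp del: run.simps)
    show ?case using Suc.IH[OF v] PrimRec.IH(2)[OF y]
      by (intro derivable_step[where S="{claim (code (PrimRec p q)) (pair a n) v,
            claim (code q) (pair a (pair n v)) y}"])
        (auto simp: step_ok_def)
  qed
  then show ?case using PrimRec.prems unfolding x .
next
  case (Search p)
  let ?found = "\<lambda>n. run p X (pair x n) = Some 0 \<and> (\<forall>k<n. run p X (pair x k) \<noteq> None)"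
  have y: "y = (LEAST n. ?found n)" and ex: "\<exists>n. ?found n"
    using Search.prems by (auto simp: Let_def split: if_splits)
  have found: "?found y"
    unfolding y using ex by (rule LeastI_ex)
  let ?v = "\<lambda>k. the (run p X (pair x k))"
  have v: "run p X (pair x k) = Some (?v k) \<and> ?v k \<noteq> 0" if "k < y" for k
  proof -
    have "\<not> ?found k" using that not_less_Least unfolding y by blast
    then show ?thesis using found that by force
  qed
  have "claim (code p) (pair x k) (?v k) \<in> (\<lambda>k. claim (code p) (pair x k) (?v k)) ` {..<y}" if "k < y" for k
    using that by blast
  then show ?case using found v Search.IH
    by (intro derivable_step[where S="insert (claim (code p) (pair x y) 0)
          ((\<lambda>k. claim (code p) (pair x k) (?v k)) ` {..<y})"])
      (auto simp: step_ok_def)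
qed (rule derivable_step[where S="{}"]; auto simp: step_ok_def pfst_def psnd_def)+

text \<open>Queries from \<open>s\<close> on have no admissible answer, so a derivation depends only
  on the oracle below \<open>s\<close>.\<close>

definition finite_answer :: "nat \<Rightarrow> nat \<Rightarrow> nat \<Rightarrow> nat \<Rightarrow> bool" where
  "finite_answer s Q x y \<longleftrightarrow> x < s \<and> y = of_bool (x \<in> set (list_decode Q))"

lemma finite_derivation:
  assumes "run \<phi> X x = Some y"
  obtains s d where "\<And>Q. (\<And>t. t < s \<Longrightarrow> t \<in> set (list_decode Q) \<longleftrightarrow> t \<in> X) \<Longrightarrow>
      derivation (finite_answer s Q) (list_decode d) \<and> claim (code \<phi>) x y \<in> set (list_decode d)"
proof -
  obtain ds where ds: "derivation (\<lambda>x y. y = of_bool (x \<in> X)) ds" "claim (code \<phi>) x y \<in> set ds"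
    using derivable_complete[OF assms] unfolding derivable_def by blast
  have less: "u < list_encode ds" if "claim c u v \<in> set ds" for c u v
    using mem_less_list_encode[OF that] le_prod_encode_1[of u v] le_prod_encode_2[of "pair u v" c]
    by linarith
  \<comment> \<open>The code of the derivation exceeds every number queried in it, so it also serves
    as the bound \<open>s\<close>.\<close>
  show thesis
  proof (rule that[of "list_encode ds" "list_encode ds"])
    fix Q assume Q: "\<And>t. t < list_encode ds \<Longrightarrow> t \<in> set (list_decode Q) \<longleftrightarrow> t \<in> X"
    have "derivation (finite_answer (list_encode ds) Q) ds"
      using ds(1) by (rule derivation_mono) (use less Q in \<open>auto simp: finite_answer_def\<close>)
    then show "derivation (finite_answer (list_encode ds) Q) (list_decode (list_encode ds)) \<and>
        claim (code \<phi>) x y \<in> set (list_decode (list_encode ds))"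
      using ds(2) by simp
  qed
qed

lemma finite_derivation_sound:
  assumes "derivation (finite_answer s Q) (list_decode d)" "claim (code \<phi>) x y \<in> set (list_decode d)"
    and "\<And>t. t < s \<Longrightarrow> t \<in> set (list_decode Q) \<longleftrightarrow> t \<in> X"
  shows "run \<phi> X x = Some y"
  using assms(1) _ assms(2) by (rule derivation_sound) (simp add: finite_answer_def assms(3))

lemma ex_code_of_finite:
  assumes "finite F"
  obtains Q where "set (list_decode Q) = F"
  using finite_list[OF assms] list_encode_inverse by metis

text \<open>The use principle: a halting computation has a finite derivation, which looks only at an
  initial segment of the oracle.\<close>

lemma run_use:
  assumes "run \<phi> X x = Some y"
  obtains s where "\<And>Y. Y \<inter> {..<s} = X \<inter> {..<s} \<Longrightarrow> run \<phi> Y x = Some y"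
proof -
  obtain s d where *: "\<And>Q. (\<And>t. t < s \<Longrightarrow> t \<in> set (list_decode Q) \<longleftrightarrow> t \<in> X) \<Longrightarrow>
      derivation (finite_answer s Q) (list_decode d) \<and> claim (code \<phi>) x y \<in> set (list_decode d)"
    using finite_derivation[OF assms] by blast
  obtain Q where Q: "set (list_decode Q) = X \<inter> {..<s}"
    using ex_code_of_finite[of "X \<inter> {..<s}"] by auto
  have "derivation (finite_answer s Q) (list_decode d) \<and> claim (code \<phi>) x y \<in> set (list_decode d)"
    using *[of Q] by (simp add: Q)
  then show thesis
    using finite_derivation_sound[of s Q d \<phi> x y] by (intro that[of s]) (auto simp: Q)
qed

text \<open>An intermediate value \<open>v\<close> occurring in a claim of the list is smaller than
  the code \<open>D\<close> of the list. Bounding the quantifiers makes the condition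
  decidable.\<close>

lemma step_ok_bounded:
  "step_ok Oa (set (list_decode D)) c x y \<longleftrightarrow>
     pfst c = 0 \<and> psnd c = 0 \<and> y = 0 \<or>
     pfst c = 1 \<and> psnd c = 0 \<and> y = Suc x \<or>
     pfst c = 2 \<and> psnd c = 0 \<and> y = pfst x \<or>
     pfst c = 3 \<and> psnd c = 0 \<and> y = psnd x \<or>
     pfst c = 4 \<and> psnd c = 0 \<and> Oa x y \<or>
     pfst c = 5 \<and> claim (pfst (psnd c)) x (pfst y) \<in> set (list_decode D) \<and>
       claim (psnd (psnd c)) x (psnd y) \<in> set (list_decode D) \<or>
     pfst c = 6 \<and> (\<exists>v<D. claim (psnd (psnd c)) x v \<in> set (list_decode D) \<and>
       claim (pfst (psnd c)) v y \<in> set (list_decode D)) \<or>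
     pfst c = 7 \<and> psnd x = 0 \<and> claim (pfst (psnd c)) (pfst x) y \<in> set (list_decode D) \<or>
     pfst c = 7 \<and> psnd x \<noteq> 0 \<and>
       (\<exists>v<D. claim c (pair (pfst x) (psnd x - 1)) v \<in> set (list_decode D) \<and>
         claim (psnd (psnd c)) (pair (pfst x) (pair (psnd x - 1) v)) y \<in> set (list_decode D)) \<or>
     pfst c = 8 \<and> claim (psnd c) (pair x y) 0 \<in> set (list_decode D) \<and>
       (\<forall>k<y. \<exists>v<D. v \<noteq> 0 \<and> claim (psnd c) (pair x k) v \<in> set (list_decode D))"
proof -
  have "v < D" if "claim e u v \<in> set (list_decode D)" for e u v
    using mem_less_list_encode[OF that] le_prod_encode_2[of v u] le_prod_encode_2[of "pair u v" e]
    by simp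
  then have "(\<exists>v. claim e u v \<in> set (list_decode D) \<and> R v) \<longleftrightarrow>
      (\<exists>v<D. claim e u v \<in> set (list_decode D) \<and> R v)"
    and "(\<exists>v. v \<noteq> 0 \<and> claim e u v \<in> set (list_decode D)) \<longleftrightarrow>
      (\<exists>v<D. v \<noteq> 0 \<and> claim e u v \<in> set (list_decode D))" for e u R
    by blast+
  then show ?thesis unfolding step_ok_def by presburger
qed

lemma derivation_list_decode_iff:
  "derivation Oa (list_decode d) \<longleftrightarrow>
    (\<forall>j<d. (ctl ^^ j) d \<noteq> 0 \<longrightarrow> step_ok Oa (set (list_decode (ctl ((ctl ^^ j) d))))
       (pfst (chd ((ctl ^^ j) d))) (pfst (psnd (chd ((ctl ^^ j) d)))) (psnd (psnd (chd ((ctl ^^ j) d)))))"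
proof -
  obtain ds where d: "d = list_encode ds" by (metis list_decode_inverse)
  have nth: "derivation Oa ds \<longleftrightarrow> (\<forall>j<length ds. step_ok Oa (set (drop (Suc j) ds))
       (pfst (ds ! j)) (pfst (psnd (ds ! j))) (psnd (psnd (ds ! j))))" for ds
    by (induction ds) (auto simp: All_less_Suc2)
  have "chd (list_encode (drop j ds)) = ds ! j" if "j < length ds" for j
    using that by (simp add: Cons_nth_drop_Suc[symmetric])
  then show ?thesis using length_le_list_encode[of ds]
    by (auto simp: d nth tl_drop drop_Suc[symmetric] not_le)
qed

lemma decidable_derivation:
  assumes "computable I Or s" "computable I Or Q" "computable I Or d"
  shows "decidable I Or (\<lambda>i x. derivation (finite_answer (s i x) (Q i x)) (list_decode (d i x)))"
proof -
  have *: "decidable I Or (\<lambda>i z. derivation (finite_answer (pfst (pfst z)) (psnd (pfst z)))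
      (list_decode (psnd z)))"
    unfolding derivation_list_decode_iff step_ok_bounded finite_answer_def
    by (intro computable_intros computable_chd computable_ctl computable_ctl_funpow decidable_mem)
  from decidable_compose[OF *, of "\<lambda>i x. pair (pair (s i x) (Q i x)) (d i x)"] assms
  show ?thesis by (simp add: computable_pair)
qed

section \<open>Columns of positive density\<close>

text \<open>The successors of column \<open>j\<close> are the numbers divisible by
  \<open>2 ^ j\<close> but not by \<open>2 ^ Suc j\<close>. So the columns partition the naturals,
  and column \<open>j\<close> has density \<open>1 / 2 ^ Suc j\<close>.\<close>

definition col :: "nat \<Rightarrow> nat \<Rightarrow> nat" where
  "col j k = 2 ^ j * (2 * k + 1) - 1"

lemma Suc_col: "Suc (col j k) = 2 ^ j * (2 * k + 1)"
  by (simp add: col_def)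

lemma col_inj [simp]: "col j k = col j' k' \<longleftrightarrow> j = j' \<and> k = k'"
proof
  assume "col j k = col j' k'"
  then have "2 ^ j * (2 * k + 1) = 2 ^ j' * (2 * k' + 1)"
    by (metis Suc_col)
  then show "j = j' \<and> k = k'"
  proof (induction j arbitrary: j')
    case 0
    then have "odd (2 ^ j' * (2 * k' + 1))" by (metis even_mult_iff mult_1 odd_two_times_div_two_succ
          power_0 dvd_triv_left even_plus_one_iff)
    then have "j' = 0" by (cases j') auto
    then show ?case using 0 by simp
  next
    case (Suc j)
    then have "even (2 ^ j' * (2 * k' + 1))" by (metis dvd_triv_left mult.assoc power_Suc)
    then obtain i where i: "j' = Suc i" by (cases j') auto
    then have "2 ^ j * (2 * k + 1) = 2 ^ i * (2 * k' + 1)"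
      using Suc.prems by (simp add: i)
    then show ?case using Suc.IH[of i] i by simp
  qed
qed simp

lemma ex_col: "\<exists>j k. m = col j k"
proof -
  have "n > 0 \<Longrightarrow> \<exists>j k. n = 2 ^ j * (2 * k + 1)" for n :: nat
  proof (induction n rule: less_induct)
    case (less n)
    show ?case
    proof (cases "odd n")
      case True
      then show ?thesis by (metis mult_1 oddE power_0)
    next
      case False
      then obtain h where h: "n = 2 * h" by auto
      then have "h < n" "0 < h" using less.prems by simp_all
      from less.IH[OF this] obtain j k where "h = 2 ^ j * (2 * k + 1)" by blast
      then show ?thesis using h by (intro exI[of _ "Suc j"] exI[of _ k]) simp
    qed
  qed
  then obtain j k where "Suc m = 2 ^ j * (2 * k + 1)" by blast
  then have "Suc m = Suc (col j k)" by (simp only: Suc_col)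
  then show ?thesis by blast
qed

lemma le_col_1: "j \<le> col j k"
proof -
  have "j < 2 ^ j" by simp
  also have "\<dots> \<le> Suc (col j k)" by (simp add: Suc_col)
  finally show ?thesis by simp
qed

lemma le_col_2: "k \<le> col j k"
proof -
  have "1 * (2 * k + 1) \<le> Suc (col j k)" unfolding Suc_col by (intro mult_le_mono) auto
  then show ?thesis by simp
qed

text \<open>A set that misses column \<open>j\<close> has relative frequency at most
  \<open>1 - 1 / 2 ^ Suc j\<close> below arbitrarily large \<open>n\<close>.\<close>

lemma density_1_meets_column:
  assumes "density_1 E"
  shows "\<exists>k. col j k \<in> E"
proof (rule ccontr)
  assume none: "\<nexists>k. col j k \<in> E"
  let ?d = "2 ^ Suc j :: nat"
  have "\<forall>\<^sub>F n in sequentially. 1 - 1 / real ?d < real (card (E \<inter> {..<n})) / real n"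
    using assms unfolding density_1_def by (rule order_tendstoD) simp
  then obtain N where N: "\<And>n. n \<ge> N \<Longrightarrow> 1 - 1 / real ?d < real (card (E \<inter> {..<n})) / real n"
    by (auto simp: eventually_sequentially)
  define K where "K = Suc N"
  \<comment> \<open>The first \<open>K\<close> members of column \<open>j\<close> lie below this
    \<open>n\<close>, a share of \<open>1 / ?d\<close>.\<close>
  define n where "n = ?d * K"
  have less: "col j k < n" if "k < K" for k
  proof -
    have "2 ^ j * (2 * k + 1) \<le> 2 ^ j * (2 * K)" using that by (intro mult_le_mono) auto
    then show ?thesis unfolding n_def using Suc_col[of j k] by simp
  qed
  have "E \<inter> {..<n} \<subseteq> {..<n} - col j ` {..<K}" using none by auto
  then have "card (E \<inter> {..<n}) \<le> card ({..<n} - col j ` {..<K})"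
    by (intro card_mono) auto
  also have "\<dots> = n - K"
    using less by (subst card_Diff_subset) (auto simp: card_image inj_on_def)
  finally have "card (E \<inter> {..<n}) \<le> n - K" .
  moreover have "1 * K \<le> n"
    unfolding n_def by (intro mult_le_mono) auto
  then have "K \<le> n" by simp
  ultimately have "real (card (E \<inter> {..<n})) \<le> real n - real K"
    by linarith
  then have "real (card (E \<inter> {..<n})) / real n \<le> (real n - real K) / real n"
    by (intro divide_right_mono) auto
  also have "\<dots> = 1 - real K / real n"
    using \<open>K \<le> n\<close> by (simp add: K_def diff_divide_distrib)
  also have "real K / real n = 1 / real ?d"
    unfolding n_def of_nat_mult by (simp add: K_def del: power_Suc)
  finally have "real (card (E \<inter> {..<n})) / real n \<le> 1 - 1 / real ?d" .
  moreover have "N \<le> n" using \<open>K \<le> n\<close> by (simp add: K_def)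
  ultimately show False using N[of n] by simp
qed

text \<open>The first \<open>J\<close> columns contribute finitely many missing points, the
  remaining columns together at most a share of \<open>1 / 2 ^ J\<close>.\<close>

lemma density_1_columns:
  assumes "\<And>j k. g j \<le> k \<Longrightarrow> col j k \<in> E"
  shows "density_1 E"
  unfolding density_1_def
proof (rule LIMSEQ_I)
  fix r :: real assume "r > 0"
  then obtain J where J: "(1 / 2) ^ J < r / 2"
    using real_arch_pow_inv[of "r / 2" "1 / 2"] by auto
  define M where "M = card (\<Union>j<J. col j ` {..<g j})"
  obtain N where N: "real M / (r / 2) < real N" using reals_Archimedean2 by blast
  have "norm (real (card (E \<inter> {..<n})) / real n - 1) < r" if n: "n \<ge> Suc N" for n
  proof -
    let ?d = "2 ^ J :: nat"
    \<comment> \<open>This includes all members below \<open>n\<close> of the columns from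
      \<open>J\<close> on, because their successors are multiples of \<open>?d\<close>.\<close>
    let ?S = "(\<lambda>i. ?d * (i + 1) - 1) ` {..<n div ?d}"
    have "{..<n} - E \<subseteq> (\<Union>j<J. col j ` {..<g j}) \<union> ?S"
    proof
      fix m assume m: "m \<in> {..<n} - E"
      obtain j k where jk: "m = col j k" using ex_col by blast
      then have k: "k < g j" using m assms[of j k] by (meson DiffD2 not_le)
      show "m \<in> (\<Union>j<J. col j ` {..<g j}) \<union> ?S"
      proof (cases "j < J")
        case True
        then show ?thesis using jk k by auto
      next
        case False
        then have "?d dvd Suc m" unfolding jk Suc_col by (simp add: le_imp_power_dvd)
        then obtain i where i: "Suc m = ?d * i" by blast
        then obtain i' where i': "i = Suc i'" by (cases i) auto
        have "?d * i \<le> n" using i m by auto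
        then have "i \<le> n div ?d" by (simp add: less_eq_div_iff_mult_less_eq mult.commute)
        then have "i' < n div ?d" using i' by simp
        moreover have "m = ?d * (i' + 1) - 1" using i i' by simp
        ultimately show ?thesis by blast
      qed
    qed
    then have "card ({..<n} - E) \<le> card ((\<Union>j<J. col j ` {..<g j}) \<union> ?S)"
      by (intro card_mono) auto
    also have "\<dots> \<le> M + card ?S" unfolding M_def by (rule card_Un_le)
    also have "card ?S \<le> n div ?d" by (metis card_image_le card_lessThan finite_lessThan)
    finally have "real (card ({..<n} - E)) \<le> real M + real (n div ?d)" by simp
    also have "real (n div ?d) \<le> real n / real ?d" by (rule of_nat_div_le_of_nat)
    finally have le: "real (card ({..<n} - E)) \<le> real M + real n / 2 ^ J" by simp
    have "card (E \<inter> {..<n}) + card ({..<n} - E) = n"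
      using card_Int_Diff[of "{..<n}" E] by (simp add: Int_commute)
    then have "real (card (E \<inter> {..<n})) = real n - real (card ({..<n} - E))" by linarith
    then have "norm (real (card (E \<inter> {..<n})) / real n - 1) = real (card ({..<n} - E)) / real n"
      using n by (simp add: diff_divide_distrib)
    also have "\<dots> \<le> (real M + real n / 2 ^ J) / real n"
      using le by (intro divide_right_mono) auto
    also have "\<dots> = real M / real n + (1 / 2) ^ J"
      using n by (simp add: field_simps power_divide)
    also have "\<dots> < r / 2 + r / 2"
    proof (intro add_strict_mono J)
      have "real M < (r / 2) * real N" using N \<open>r > 0\<close> by (simp add: field_simps)
      also have "\<dots> \<le> (r / 2) * real n" using n \<open>r > 0\<close> by (intro mult_left_mono) auto
      finally show "real M / real n < r / 2" using n by (simp add: field_simps)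
    qed
    finally show ?thesis by simp
  qed
  then show "\<exists>no. \<forall>n\<ge>no. norm (real (card (E \<inter> {..<n})) / real n - 1) < r" by blast
qed

lemma computable_col:
  "computable I Or f \<Longrightarrow> computable I Or g \<Longrightarrow> computable I Or (\<lambda>i x. col (f i x) (g i x))"
  unfolding col_def by (intro computable_intros)

lemma computable_triple:
  "computable I Or f \<Longrightarrow> computable I Or g \<Longrightarrow> computable I Or h \<Longrightarrow>
    computable I Or (\<lambda>i x. triple (f i x) (g i x) (h i x))"
  unfolding triple_def by (intro computable_intros)

section \<open>The coding\<close>

text \<open>
  Nodes are sequences of naturals, coded with the most recent entry first.
\<close>

definition alive :: "nat set \<Rightarrow> nat \<Rightarrow> bool" where
  "alive X u \<longleftrightarrow> (\<exists>\<tau>. list_encode \<tau> \<in> X \<and> list_all2 (\<le>) \<tau> (rev (list_decode u)))"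

abbreviation child :: "nat \<Rightarrow> nat \<Rightarrow> nat" where
  "child k u \<equiv> Suc (pair k u)"

definition node :: "nat set \<Rightarrow> nat set \<Rightarrow> nat \<Rightarrow> nat \<Rightarrow> bool" where
  "node X G n u \<longleftrightarrow> alive X u \<and> pair n u \<in> G"

text \<open>A first component \<open>0\<close> of \<open>j\<close> is reserved for aliveness, where
  every \<open>k\<close> gives the same answer; hence the shift by one for the edges.\<close>

definition entry :: "nat set \<Rightarrow> nat set \<Rightarrow> nat \<Rightarrow> nat \<Rightarrow> bool" where
  "entry X G j k \<longleftrightarrow>
     (if pfst j = 0 then alive X (psnd j)
      else node X G (pfst j - 1) (psnd j) \<noteq> node X G (pfst j - 1) (child k (psnd j)))"

definition real_A :: "nat set \<Rightarrow> nat set \<Rightarrow> nat set" where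
  "real_A X G = {col j k | j k. entry X G j k}"

text \<open>Repeating a bit throughout a column of positive density forces every generic computation
  to give it at least once.\<close>

definition real_B :: "nat set \<Rightarrow> nat set \<Rightarrow> nat set" where
  "real_B X G = {col n k | n k. node X G n 0}"

lemma col_in_real_A [simp]: "col j k \<in> real_A X G \<longleftrightarrow> entry X G j k"
  and col_in_real_B [simp]: "col n k \<in> real_B X G \<longleftrightarrow> node X G n 0"
  by (auto simp: real_A_def real_B_def)

section \<open>Decidability of labels and edges\<close>

lemma pfst_0: "pfst 0 = 0"
  using pfst_pair[of 0 0] by (simp add: prod_encode_def del: pfst_pair)

text \<open>The coding of lists is monotone, so the search in \<open>alive\<close> for a dominated
  sequence is bounded by the code of the dominating one.\<close>

lemma list_all2_le_list_encode: "list_all2 (\<le>) xs ys \<Longrightarrow> list_encode xs \<le> list_encode ys"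
proof (induction rule: list_all2_induct)
  case (Cons x xs y ys)
  have "pair x (list_encode xs) \<le> pair y (list_encode ys)"
    using Cons unfolding prod_encode_def triangle_def
    by (auto intro!: add_mono div_le_mono mult_le_mono)
  then show ?case by simp
qed simp

text \<open>Beyond the end of a list the iterate and its head are \<open>0\<close>, so comparing
  there does no harm. If the lengths differ, the shorter one is less than \<open>c + d\<close>, and
  the mismatch shows there.\<close>

lemma list_all2_le_list_decode_iff:
  "list_all2 (\<le>) (list_decode c) (list_decode d) \<longleftrightarrow>
    (\<forall>j<c + d. ((ctl ^^ j) c = 0 \<longleftrightarrow> (ctl ^^ j) d = 0) \<and> chd ((ctl ^^ j) c) \<le> chd ((ctl ^^ j) d))"
proof -
  obtain xs ys where c: "c = list_encode xs" and d: "d = list_encode ys"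
    by (rule that[of "list_decode c" "list_decode d"]) simp_all
  have chd: "chd (list_encode (drop j zs)) = (if j < length zs then zs ! j else 0)" for j zs
    by (cases "j < length zs") (simp_all add: Cons_nth_drop_Suc[symmetric] chd_def pfst_0)
  have len: "length xs \<le> c" "length ys \<le> d" by (simp_all add: c d length_le_list_encode)
  show ?thesis (is "?L \<longleftrightarrow> ?R")
  proof
    assume ?L
    then show ?R by (auto simp: c d chd list_all2_conv_all_nth)
  next
    assume R: ?R
    have same: "length xs \<le> j \<longleftrightarrow> length ys \<le> j" if "j < c + d" for j
      using R that by (auto simp: c d)
    have "length xs = length ys"
      using same[of "length xs"] same[of "length ys"] len by (cases "length xs" "length ys" rule: linorder_cases) auto
    moreover have "xs ! j \<le> ys ! j" if "j < length xs" "j < length ys" for j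
    proof -
      have "j < c + d" using that len by simp
      then show ?thesis using R that by (auto simp: c d chd)
    qed
    ultimately show ?L by (simp add: c d list_all2_conv_all_nth)
  qed
qed

lemma alive_iff:
  "alive X u \<longleftrightarrow> (\<exists>c\<le>crev u. c \<in> X \<and>
     (\<forall>j<c + crev u. ((ctl ^^ j) c = 0 \<longleftrightarrow> (ctl ^^ j) (crev u) = 0) \<and>
        chd ((ctl ^^ j) c) \<le> chd ((ctl ^^ j) (crev u))))"
proof -
  have u: "rev (list_decode u) = list_decode (crev u)"
    using crev_list_encode[of "list_decode u"] by simp
  show ?thesis
    unfolding alive_def u list_all2_le_list_decode_iff[symmetric]
    by (metis list_all2_le_list_encode list_decode_inverse list_encode_inverse)
qed

lemma decidable_alive:
  assumes "decidable I Or (\<lambda>i x. x \<in> Xs i)" "computable I Or f"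
  shows "decidable I Or (\<lambda>i x. alive (Xs i) (f i x))"
proof -
  have "decidable I Or (\<lambda>i x. alive (Xs i) x)"
    unfolding alive_iff by (intro computable_intros computable_chd computable_ctl_funpow
        computable_crev decidable_compose[OF assms(1)])
  from decidable_compose[OF this assms(2)] show ?thesis .
qed

text \<open>The set of bits may vary with the input: it is a finite string coded in the input for
  the diagonalization, but \<open>generic X\<close> when the pair of reals is computed.\<close>

lemma decidable_node:
  assumes "decidable I Or (\<lambda>i x. x \<in> Xs i)" "decidable I Or (\<lambda>i z. psnd z \<in> Gs i (pfst z))"
    and "computable I Or n" "computable I Or u"
  shows "decidable I Or (\<lambda>i x. node (Xs i) (Gs i x) (n i x) (u i x))"
proof -
  have "decidable I Or (\<lambda>i x. psnd (pair x (pair (n i x) (u i x))) \<in> Gs i (pfst (pair x (pair (n i x) (u i x)))))"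
    by (rule decidable_compose[OF assms(2)]) (intro computable_intros assms(3,4))
  then show ?thesis
    unfolding node_def by (simp add: decidable_conj decidable_alive[OF assms(1,4)])
qed

lemma decidable_entry:
  assumes "decidable I Or (\<lambda>i x. x \<in> Xs i)" "decidable I Or (\<lambda>i z. psnd z \<in> Gs i (pfst z))"
    and "computable I Or j" "computable I Or k"
  shows "decidable I Or (\<lambda>i x. entry (Xs i) (Gs i x) (j i x) (k i x))"
  unfolding entry_def
  by (intro computable_intros decidable_if decidable_alive[OF assms(1)]
      decidable_node[OF assms(1,2)] assms(3,4))

section \<open>Diagonalization\<close>

text \<open>
  A length \<open>len\<close> together with (the code of) a finite set stands for a string of length \<open>len\<close>. The
  bound on the indices ensures that every extension of the string yields the same bit of \<open>A\<close>.
\<close>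

definition truthful :: "nat set \<Rightarrow> nat \<Rightarrow> nat set \<Rightarrow> nat \<Rightarrow> bool" where
  "truthful X len G t \<longleftrightarrow> (\<exists>j\<le>pfst t. \<exists>k\<le>pfst t. pfst t = col j k \<and>
     pfst (psnd t) = of_bool (entry X G j k) \<and>
     (pfst j \<noteq> 0 \<longrightarrow> pair (pfst j - 1) (psnd j) < len \<and> pair (pfst j - 1) (child k (psnd j)) < len))"

text \<open>
  The string \<open>(len', Q')\<close> extends \<open>(len, Q)\<close>, and \<open>d\<close> shows that the functional with code \<open>e\<close> makes a
  mistake in the \<open>n\<close>th column of \<open>B\<close> when run with an oracle that coincides with \<open>R\<close> below \<open>s\<close>.
\<close>

definition defeat :: "nat set \<Rightarrow> nat \<Rightarrow> nat \<Rightarrow> nat \<Rightarrow> nat \<Rightarrow> nat \<Rightarrow>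
    nat \<Rightarrow> nat \<Rightarrow> nat \<Rightarrow> nat \<Rightarrow> nat \<Rightarrow> nat \<Rightarrow> bool" where
  "defeat X e len Q len' Q' s R d n k v \<longleftrightarrow>
     len \<le> len' \<and> (\<forall>i<len. i \<in> set (list_decode Q') \<longleftrightarrow> i \<in> set (list_decode Q)) \<and>
     (\<forall>t<s. t \<in> set (list_decode R) \<longrightarrow> truthful X len' (set (list_decode Q')) t) \<and>
     derivation (finite_answer s R) (list_decode d) \<and> claim e (col n k) v \<in> set (list_decode d) \<and>
     pair n 0 < len' \<and> v \<noteq> of_bool (node X (set (list_decode Q')) n 0)"

text \<open>All parts of a witness are packed into one number, so that asking for a witness is one
  unbounded search, which the jump can decide.\<close>

definition defeated :: "nat set \<Rightarrow> nat \<Rightarrow> nat \<Rightarrow> nat \<Rightarrow> bool" where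
  "defeated X e st w \<longleftrightarrow>
     defeat X e (pfst st) (psnd st) (pfst (pfst w)) (psnd (pfst w))
       (pfst (pfst (psnd w))) (psnd (pfst (psnd w))) (pfst (psnd (psnd w)))
       (pfst (psnd (psnd (psnd w)))) (pfst (psnd (psnd (psnd (psnd w)))))
       (psnd (psnd (psnd (psnd (psnd w)))))"

section \<open>Decidability of defeat\<close>

lemma decidable_id_oracle: "decidable I (\<lambda>X. X) (\<lambda>X x. x \<in> X)"
  by (rule decidable_oracle[OF computable_id])

lemma decidable_truthful:
  assumes "computable UNIV (\<lambda>X. X) len" "computable UNIV (\<lambda>X. X) Q" "computable UNIV (\<lambda>X. X) t"
  shows "decidable UNIV (\<lambda>X. X) (\<lambda>X x. truthful X (len X x) (set (list_decode (Q X x))) (t X x))"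
proof -
  have "decidable UNIV (\<lambda>X. X) (\<lambda>X z. truthful X (pfst (pfst z)) (set (list_decode (psnd (pfst z)))) (psnd z))"
    unfolding truthful_def
    by (intro computable_intros computable_col decidable_entry[OF decidable_id_oracle] decidable_mem)
  from decidable_compose[OF this, of "\<lambda>X x. pair (pair (len X x) (Q X x)) (t X x)"] assms
  show ?thesis by (simp add: computable_pair)
qed

lemma decidable_defeated:
  assumes "computable UNIV (\<lambda>X. X) e" "computable UNIV (\<lambda>X. X) st" "computable UNIV (\<lambda>X. X) w"
  shows "decidable UNIV (\<lambda>X. X) (\<lambda>X x. defeated X (e X x) (st X x) (w X x))"
proof -
  have "decidable UNIV (\<lambda>X. X) (\<lambda>X z. defeated X (pfst (pfst z)) (psnd (pfst z)) (psnd z))"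
    unfolding defeated_def defeat_def
    by (intro computable_intros computable_col decidable_truthful decidable_mem decidable_derivation
        decidable_node[OF decidable_id_oracle])
  from decidable_compose[OF this, of "\<lambda>X x. pair (pair (e X x) (st X x)) (w X x)"] assms
  show ?thesis by (simp add: computable_pair)
qed

text \<open>The implication makes the least number exist in all cases, as
  \<open>computable_Least\<close> requires.\<close>

definition witness :: "nat set \<Rightarrow> nat \<Rightarrow> nat \<Rightarrow> nat" where
  "witness X e st = (LEAST w. (\<exists>w. defeated X e st w) \<longrightarrow> defeated X e st w)"

text \<open>Finite extension: step \<open>e\<close> defeats the functional with code
  \<open>e\<close> if some extension of the current string can. A state is a length with the code of
  a finite set; \<open>Suc\<close> makes the length grow even when there is nothing to do.\<close>

definition stage :: "nat set \<Rightarrow> nat \<Rightarrow> nat" where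
  "stage X = rec_nat (pair 0 0) (\<lambda>e st.
     if \<exists>w. defeated X e st w
     then pair (Suc (pfst (pfst (witness X e st)))) (psnd (pfst (witness X e st)))
     else pair (Suc (pfst st)) (psnd st))"

text \<open>Stage \<open>Suc i\<close> has length more than \<open>i\<close>, hence fixes bit
  \<open>i\<close>.\<close>

definition generic :: "nat set \<Rightarrow> nat set" where
  "generic X = {i. i \<in> set (list_decode (psnd (stage X (Suc i))))}"

section \<open>Coherence of the stages\<close>

lemma stage_Suc:
  "stage X (Suc e) =
     (if \<exists>w. defeated X e (stage X e) w
      then pair (Suc (pfst (pfst (witness X e (stage X e))))) (psnd (pfst (witness X e (stage X e))))
      else pair (Suc (pfst (stage X e))) (psnd (stage X e)))"
  unfolding stage_def by (simp only: nat.rec)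

lemma defeated_witness: "defeated X e st w \<Longrightarrow> defeated X e st (witness X e st)"
  unfolding witness_def by (rule LeastI2_ex) blast+

lemma defeated_extends:
  assumes "defeated X e st w"
  shows "pfst st \<le> pfst (pfst w)"
    and "i < pfst st \<Longrightarrow> i \<in> set (list_decode (psnd (pfst w))) \<longleftrightarrow> i \<in> set (list_decode (psnd st))"
  using assms by (simp_all add: defeated_def defeat_def)

lemma stage_step:
  "pfst (stage X e) < pfst (stage X (Suc e)) \<and> (\<forall>i<pfst (stage X e).
      i \<in> set (list_decode (psnd (stage X (Suc e)))) \<longleftrightarrow> i \<in> set (list_decode (psnd (stage X e))))"
proof (cases "\<exists>w. defeated X e (stage X e) w")
  case True
  let ?w = "witness X e (stage X e)"
  have eq: "stage X (Suc e) = pair (Suc (pfst (pfst ?w))) (psnd (pfst ?w))"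
    using True by (simp only: stage_Suc if_True)
  have "defeated X e (stage X e) ?w"
    using True defeated_witness by blast
  from defeated_extends[OF this] show ?thesis
    unfolding eq by (simp add: less_Suc_eq_le)
next
  case False
  then show ?thesis by (simp only: stage_Suc if_False) simp
qed

lemma stage_mono: "e \<le> e' \<Longrightarrow> pfst (stage X e) \<le> pfst (stage X e')"
  by (rule lift_Suc_mono_le[of "\<lambda>e. pfst (stage X e)"]) (use stage_step[of X] in \<open>auto intro: less_imp_le\<close>)

lemma le_stage: "e \<le> pfst (stage X e)"
proof (induction e)
  case (Suc e)
  then show ?case using stage_step[of X e] by linarith
qed simp

lemma stage_coherent:
  assumes "i < pfst (stage X e)" "e \<le> e'"
  shows "i \<in> set (list_decode (psnd (stage X e'))) \<longleftrightarrow> i \<in> set (list_decode (psnd (stage X e)))"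
  using assms(2)
proof (induction rule: dec_induct)
  case (step n)
  then show ?case using stage_step[of X n] stage_mono[of e n X] assms(1) by simp
qed simp

lemma generic_iff:
  assumes "i < pfst (stage X e)"
  shows "i \<in> generic X \<longleftrightarrow> i \<in> set (list_decode (psnd (stage X e)))"
proof -
  have "i < pfst (stage X (Suc i))" using le_stage[of "Suc i" X] by simp
  then show ?thesis
    using stage_coherent[OF assms, of "Suc i"] stage_coherent[of i X "Suc i" e] assms
    unfolding generic_def by (cases "e \<le> Suc i") auto
qed

text \<open>Each step asks whether a witness exists, an existential question about \<open>X\<close>,
  and then searches for the least one; the jump can do both.\<close>

lemma computable_stage: "computable UNIV jump stage"
proof -
  have "decidable UNIV jump (\<lambda>X y. \<exists>w. defeated X (pfst y) (psnd y) w)"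
    by (intro decidable_jump_Ex decidable_defeated computable_intros)
  note ex = decidable_compose[OF this]
  have ex': "decidable UNIV jump (\<lambda>X x. \<exists>w. defeated X (f X x) (g X x) w)"
    if "computable UNIV jump f" "computable UNIV jump g" for f g
    using ex[OF computable_pair[OF that]] by simp
  have "decidable UNIV jump (\<lambda>X z. defeated X (pfst (pfst z)) (psnd (pfst z)) (psnd z))"
    by (intro decidable_jump decidable_defeated computable_intros)
  note def = decidable_compose[OF this]
  have def': "decidable UNIV jump (\<lambda>X x. defeated X (f X x) (g X x) (h X x))"
    if "computable UNIV jump f" "computable UNIV jump g" "computable UNIV jump h" for f g h
    using def[OF computable_pair[OF computable_pair[OF that(1,2)] that(3)]] by simp
  have "computable UNIV jump (\<lambda>X y. witness X (pfst y) (psnd y))"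
    unfolding witness_def by (intro computable_Least decidable_imp ex' def' computable_intros) blast
  note wit = computable_compose[OF this]
  have wit': "computable UNIV jump (\<lambda>X x. witness X (f X x) (g X x))"
    if "computable UNIV jump f" "computable UNIV jump g" for f g
    using wit[OF computable_pair[OF that]] by simp
  show ?thesis
    unfolding stage_def
    by (intro computable_rec_nat[where n="\<lambda>X x. x"] ex' wit' computable_intros)
qed

lemma decidable_generic: "decidable UNIV jump (\<lambda>X x. x \<in> generic X)"
  unfolding generic_def mem_Collect_eq
  by (intro decidable_mem computable_compose[OF computable_stage] computable_intros)

lemma decidable_real_A: "decidable UNIV jump (\<lambda>X x. x \<in> real_A X (generic X))"
proof -
  have "x \<in> real_A X G \<longleftrightarrow> (\<exists>j\<le>x. \<exists>k\<le>x. x = col j k \<and> entry X G j k)" for x X G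
    unfolding real_A_def using le_col_1 le_col_2 by blast
  then show ?thesis
    by (simp only:) (intro computable_intros computable_col decidable_entry
        decidable_jump[OF decidable_id_oracle] decidable_compose[OF decidable_generic])
qed

lemma decidable_real_B: "decidable UNIV jump (\<lambda>X x. x \<in> real_B X (generic X))"
proof -
  have "x \<in> real_B X G \<longleftrightarrow> (\<exists>j\<le>x. \<exists>k\<le>x. x = col j k \<and> node X G j 0)" for x X G
    unfolding real_B_def using le_col_1 le_col_2 by blast
  then show ?thesis
    by (simp only:) (intro computable_intros computable_col decidable_node
        decidable_jump[OF decidable_id_oracle] decidable_compose[OF decidable_generic])
qed

lemma join_computed_from_jump:
  "\<exists>\<Phi>. \<forall>X. computes (run \<Phi> (jump X)) (join (real_A X (generic X)) (real_B X (generic X)))"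
proof -
  have "x \<in> join A B \<longleftrightarrow> (\<exists>n\<le>x. (x = 2 * n \<and> n \<in> A) \<or> (x = 2 * n + 1 \<and> n \<in> B))" for x A B
  proof -
    have "x = 2 * n \<and> n \<in> A \<or> x = 2 * n + 1 \<and> n \<in> B \<Longrightarrow> n \<le> x" for n by auto
    then show ?thesis unfolding join_def by blast
  qed
  then have "decidable UNIV jump (\<lambda>X x. x \<in> join (real_A X (generic X)) (real_B X (generic X)))"
    by (simp only:) (intro computable_intros decidable_compose[OF decidable_real_A]
        decidable_compose[OF decidable_real_B])
  then show ?thesis
    unfolding decidable_def computable_def computes_def by (simp add: of_bool_def)
qed

section \<open>Well-founded trees\<close>

text \<open>The sequences in \<open>T\<close> dominated by \<open>f\<close> form a finitely
  branching tree of unbounded height. This is why the upward closure of a well-founded tree is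
  well-founded.\<close>

lemma Koenig:
  assumes "is_tree T" "\<And>i. \<exists>\<tau>\<in>T. list_all2 (\<le>) \<tau> (map f [0..<i])"
  shows "\<not> well_founded_tree T"
proof -
  \<comment> \<open>Having dominated extensions in \<open>T\<close> of every length is the property
    to be kept along the path.\<close>
  define good where "good s \<longleftrightarrow> (\<forall>m. \<exists>\<tau>. length \<tau> = m \<and> s @ \<tau> \<in> T \<and>
      list_all2 (\<le>) (s @ \<tau>) (map f [0..<length s + m]))" for s
  have "good []"
    unfolding good_def
  proof
    fix m
    obtain \<tau> where \<tau>: "\<tau> \<in> T" "list_all2 (\<le>) \<tau> (map f [0..<m])" using assms(2) by blast
    then have "length \<tau> = m" using list_all2_lengthD by fastforce
    then show "\<exists>\<tau>. length \<tau> = m \<and> [] @ \<tau> \<in> T \<and> list_all2 (\<le>) ([] @ \<tau>) (map f [0..<length [] + m])"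
      using \<tau> by auto
  qed
  have ext: "\<exists>v. good (s @ [v])" if s: "good s" for s
  proof (rule ccontr)
    assume "\<nexists>v. good (s @ [v])"
    then have "\<exists>m. \<forall>\<tau>. \<not> (length \<tau> = m \<and> (s @ [v]) @ \<tau> \<in> T \<and>
        list_all2 (\<le>) ((s @ [v]) @ \<tau>) (map f [0..<length (s @ [v]) + m]))" for v
      unfolding good_def by meson
    then obtain h where h: "\<And>v \<tau>. \<not> (length \<tau> = h v \<and> (s @ [v]) @ \<tau> \<in> T \<and>
        list_all2 (\<le>) ((s @ [v]) @ \<tau>) (map f [0..<length (s @ [v]) + h v]))"
      by metis
    \<comment> \<open>If each one-point extension fails at a height \<open>h v\<close>, the sum over
      the finitely many \<open>v\<close> allowed by \<open>f\<close> bounds all these heights. A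
      longer extension of \<open>s\<close> then contradicts the failure for its first entry.\<close>
    define M where "M = (\<Sum>v\<le>f (length s). h v)"
    obtain \<tau> where \<tau>: "length \<tau> = Suc M" "s @ \<tau> \<in> T"
      "list_all2 (\<le>) (s @ \<tau>) (map f [0..<length s + Suc M])"
      using s unfolding good_def by meson
    then obtain v \<rho> where \<rho>: "\<tau> = v # \<rho>" "length \<rho> = M" by (cases \<tau>) auto
    have nth: "(s @ \<tau>) ! i \<le> f i" if "i < length s + Suc M" for i
      using \<tau>(3) that by (auto simp: list_all2_conv_all_nth simp del: upt_Suc)
    have "v \<le> f (length s)" using nth[of "length s"] by (simp add: \<rho>)
    then have le: "h v \<le> M" unfolding M_def by (intro member_le_sum) auto
    let ?\<rho> = "take (h v) \<rho>"
    have split: "s @ \<tau> = ((s @ [v]) @ ?\<rho>) @ drop (h v) \<rho>" by (simp add: \<rho>)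
    have "(s @ [v]) @ ?\<rho> \<in> T"
      using assms(1) \<tau>(2) unfolding is_tree_def split by blast
    moreover have "((s @ [v]) @ ?\<rho>) ! i \<le> f i" if "i < length (s @ [v]) + h v" for i
    proof -
      have "((s @ [v]) @ ?\<rho>) ! i = (s @ \<tau>) ! i"
        unfolding split using that \<rho>(2) le by (subst nth_append[of "(s @ [v]) @ ?\<rho>"]) simp
      then show ?thesis using nth[of i] that le by simp
    qed
    ultimately show False
      using h[of ?\<rho> v] \<rho>(2) le by (simp add: list_all2_conv_all_nth del: append_assoc upt_Suc)
  qed
  define p where "p = rec_nat [] (\<lambda>_ s. s @ [SOME v. good (s @ [v])])"
  define g where "g n = (SOME v. good (p n @ [v]))" for n
  have p_0: "p 0 = []" and p_Suc: "p (Suc n) = p n @ [g n]" for n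
    by (simp_all add: p_def g_def)
  have good: "good (p n)" for n
    by (induction n) (use \<open>good []\<close> ext in \<open>auto simp: p_0 p_Suc g_def intro: someI_ex\<close>)
  have "p n = map g [0..<n]" for n by (induction n) (simp_all add: p_0 p_Suc)
  moreover have "p n \<in> T" for n using good[of n] unfolding good_def by fastforce
  ultimately show ?thesis unfolding well_founded_tree_def by metis
qed

text \<open>\<open>w\<close> codes a position in column \<open>j\<close>, a bit and the third
  component of a triple; an unbounded search finds the least one.\<close>

definition answer :: "nat set \<Rightarrow> nat \<Rightarrow> nat" where
  "answer P j = (LEAST w. triple (col j (pfst w)) (pfst (psnd w)) (psnd (psnd w)) \<in> P)"

lemma ex_answer:
  assumes "generic_oracle P A"
  shows "\<exists>w. triple (col j (pfst w)) (pfst (psnd w)) (psnd (psnd w)) \<in> P"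
proof -
  obtain k where "col j k \<in> oracle_dom P"
    using density_1_meets_column assms unfolding generic_oracle_def by blast
  then obtain x l where "triple (col j k) x l \<in> P" unfolding oracle_dom_def by blast
  then show ?thesis by (intro exI[of _ "pair k (pair x l)"]) simp
qed

lemma answer_bit:
  assumes "generic_oracle P (real_A X G)"
  shows "pfst (psnd (answer P j)) = of_bool (entry X G j (pfst (answer P j)))"
proof -
  have "triple (col j (pfst (answer P j))) (pfst (psnd (answer P j))) (psnd (psnd (answer P j))) \<in> P"
    unfolding answer_def by (rule LeastI_ex) (rule ex_answer[OF assms])
  then show ?thesis
    using assms unfolding generic_oracle_def partial_oracle_def
    by (metis (full_types) One_nat_def col_in_real_A insertE of_bool_eq(1) of_bool_eq(2) singletonD)
qed

text \<open>
  Follow the oracle's answers from the root, adding up the bits that label the edges. The second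
  component of the state is the parity of the bits seen so far.
\<close>

definition walk :: "nat set \<Rightarrow> nat \<Rightarrow> nat \<Rightarrow> nat" where
  "walk P n = rec_nat (pair 0 0) (\<lambda>_ st.
     pair (child (pfst (answer P (pair (Suc n) (pfst st)))) (pfst st))
       (of_bool (psnd st \<noteq> pfst (psnd (answer P (pair (Suc n) (pfst st)))))))"

lemma walk_0: "walk P n 0 = pair 0 0"
  and walk_Suc: "walk P n (Suc i) =
     pair (child (pfst (answer P (pair (Suc n) (pfst (walk P n i))))) (pfst (walk P n i)))
       (of_bool (psnd (walk P n i) \<noteq> pfst (psnd (answer P (pair (Suc n) (pfst (walk P n i)))))))"
  unfolding walk_def by (simp_all only: nat.rec)

text \<open>The sum of the edge labels telescopes modulo 2, leaving the labels of the two ends of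
  the walk.\<close>

lemma walk_invariant:
  assumes "generic_oracle P (real_A X G)"
  shows "psnd (walk P n i) = of_bool (node X G n (pfst (walk P n i)) \<noteq> node X G n 0)"
proof (induction i)
  case (Suc i)
  show ?case
    unfolding walk_Suc using answer_bit[OF assms, of "pair (Suc n) (pfst (walk P n i))"] Suc
    by (auto simp: entry_def)
qed (simp add: walk_0)

text \<open>A walk that stays alive forever traces an \<open>f\<close> all of whose initial segments
  dominate members of \<open>T\<close>, against \<open>Koenig\<close>.\<close>

lemma ex_walk_dead:
  assumes "is_tree T" "well_founded_tree T"
  shows "\<exists>i. \<not> alive (tree_code T) (pfst (walk P n i))"
proof (rule ccontr)
  assume "\<nexists>i. \<not> alive (tree_code T) (pfst (walk P n i))"
  then have alive: "alive (tree_code T) (pfst (walk P n i))" for i by blast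
  define f where "f i = pfst (answer P (pair (Suc n) (pfst (walk P n i))))" for i
  have "pfst (walk P n i) = list_encode (rev (map f [0..<i]))" for i
    by (induction i) (simp_all add: walk_0 walk_Suc f_def)
  then have "\<exists>\<tau>. list_encode \<tau> \<in> tree_code T \<and> list_all2 (\<le>) \<tau> (map f [0..<i])" for i
    using alive[of i] by (simp add: alive_def)
  then have "\<exists>\<tau>\<in>T. list_all2 (\<le>) \<tau> (map f [0..<i])" for i
    unfolding tree_code_def using inj_list_encode by (metis image_iff list_encode_eq)
  then show False using Koenig assms by blast
qed

lemma computable_answer:
  assumes "computable {P. generic_oracle P A} (\<lambda>P. P) f"
  shows "computable {P. generic_oracle P A} (\<lambda>P. P) (\<lambda>P x. answer P (f P x))"
proof -
  have "computable {P. generic_oracle P A} (\<lambda>P. P) (\<lambda>P x. answer P x)"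
    unfolding answer_def
  proof (rule computable_Least)
    show "decidable {P. generic_oracle P A} (\<lambda>P. P)
        (\<lambda>P z. triple (col (pfst z) (pfst (psnd z))) (pfst (psnd (psnd z))) (psnd (psnd (psnd z))) \<in> P)"
      by (intro computable_intros computable_triple computable_col)
    show "\<exists>w. triple (col x (pfst w)) (pfst (psnd w)) (psnd (psnd w)) \<in> P"
      if "P \<in> {P. generic_oracle P A}" for P x
      using that ex_answer by blast
  qed
  from computable_compose[OF this assms] show ?thesis .
qed

text \<open>Walk until the oracle reports a dead node. Its label is \<open>0\<close>, so by the
  invariant the parity is the label of the root. This computation is total and correct
  everywhere.\<close>

theorem well_founded_imp_generic_ge:
  assumes "is_tree T" "well_founded_tree T"
  shows "real_A (tree_code T) G \<ge>\<^sub>g real_B (tree_code T) G"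
proof -
  let ?X = "tree_code T"
  let ?I = "{P. generic_oracle P (real_A ?X G)}"
  \<comment> \<open>The index of the column that contains \<open>m\<close>.\<close>
  let ?n = "\<lambda>m. LEAST n. \<exists>k\<le>m. m = col n k"
  define dead where "dead P n i \<longleftrightarrow> pfst (psnd (answer P (pair 0 (pfst (walk P n i))))) = 0" for P n i
  define stop where "stop P n = (LEAST i. dead P n i)" for P n
  have dead: "dead P n i \<longleftrightarrow> \<not> alive ?X (pfst (walk P n i))" if "P \<in> ?I" for P n i
    using answer_bit[of P ?X G "pair 0 (pfst (walk P n i))"] that by (simp add: dead_def entry_def)
  have ex_dead: "\<exists>i. dead P n i" if "P \<in> ?I" for P n
    using dead[OF that] ex_walk_dead[OF assms] by blast
  have walk: "computable ?I (\<lambda>P. P) (\<lambda>P x. walk P (f P x) (g P x))"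
    if "computable ?I (\<lambda>P. P) f" "computable ?I (\<lambda>P. P) g" for f g
  proof -
    have "computable ?I (\<lambda>P. P) (\<lambda>P z. walk P (pfst z) (psnd z))"
      unfolding walk_def by (intro computable_rec_nat computable_answer computable_intros)
    from computable_compose[OF this computable_pair[OF that]] show ?thesis by simp
  qed
  have "computable ?I (\<lambda>P. P) stop"
    unfolding stop_def
  proof (rule computable_Least)
    show "decidable ?I (\<lambda>P. P) (\<lambda>P z. dead P (pfst z) (psnd z))"
      unfolding dead_def by (intro computable_intros computable_answer walk)
  qed (rule ex_dead)
  note stop = computable_compose[OF this]
  have n: "computable ?I (\<lambda>P. P) (\<lambda>P m. ?n m)"
  proof (rule computable_Least)
    show "decidable ?I (\<lambda>P. P) (\<lambda>P z. \<exists>k\<le>pfst z. pfst z = col (psnd z) k)"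
      by (intro computable_intros computable_col)
    show "\<exists>n. \<exists>k\<le>m. m = col n k" for m
      using ex_col[of m] le_col_2 by metis
  qed
  have "computable ?I (\<lambda>P. P) (\<lambda>P m. psnd (walk P (?n m) (stop P (?n m))))"
    by (intro computable_psnd walk n stop)
  then obtain p where
    p: "\<And>P m. P \<in> ?I \<Longrightarrow> run p P m = Some (psnd (walk P (?n m) (stop P (?n m))))"
    by (rule computableE) blast
  have "psnd (walk P (?n m) (stop P (?n m))) = of_bool (m \<in> real_B ?X G)" if P: "P \<in> ?I" for P m
  proof -
    obtain n k where m: "m = col n k" using ex_col by blast
    then have "?n m = n" using le_col_2[of k n] by (intro Least_equality) auto
    moreover have "dead P n (stop P n)" unfolding stop_def using ex_dead[OF P] by (rule LeastI_ex)
    then have "\<not> node ?X G n (pfst (walk P n (stop P n)))" using dead[OF P] by (simp add: node_def)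
    ultimately show ?thesis using walk_invariant[of P ?X G n "stop P n"] P by (simp add: m)
  qed
  then have "run p P m = Some (if m \<in> real_B ?X G then 1 else 0)" if "generic_oracle P (real_A ?X G)" for P m
    using p[of P m] that by simp
  moreover have "density_1 UNIV" by (rule density_1_columns[of "\<lambda>_. 0"]) simp
  ultimately show ?thesis
    unfolding generic_ge_def generic_computation_def
    by (intro exI[of _ p]) (auto simp: dom_def ran_def split: if_splits)
qed

section \<open>Ill-founded trees\<close>

lemma generic_oracleI:
  assumes "\<And>t. t \<in> P \<Longrightarrow> pfst (psnd t) = of_bool (pfst t \<in> A)"
    and "\<And>j k. g j \<le> k \<Longrightarrow> \<exists>l. triple (col j k) (of_bool (col j k \<in> A)) l \<in> P"
  shows "generic_oracle P A"
proof -
  have bit: "x = of_bool (n \<in> A)" if "triple n x l \<in> P" for n x l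
    using assms(1)[OF that] by (simp add: triple_def)
  have "partial_oracle P A"
    unfolding partial_oracle_def
  proof (intro conjI allI impI)
    show "x \<in> {0, 1}" if "triple n x l \<in> P" for n x l
      using bit[OF that] by (cases "n \<in> A") auto
    show "n \<notin> A" if "triple n 0 l \<in> P" for n l
      using bit[OF that] by (cases "n \<in> A") auto
    show "n \<in> A" if "triple n 1 l \<in> P" for n l
      using bit[OF that] by (cases "n \<in> A") auto
  qed
  moreover have "density_1 (oracle_dom P)"
    by (rule density_1_columns[of g]) (use assms(2) in \<open>unfold oracle_dom_def, blast\<close>)
  ultimately show ?thesis unfolding generic_oracle_def by blast
qed

lemma entry_cong:
  assumes "pfst j \<noteq> 0 \<Longrightarrow> pair (pfst j - 1) (psnd j) \<in> G \<longleftrightarrow> pair (pfst j - 1) (psnd j) \<in> G'"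
    and "pfst j \<noteq> 0 \<Longrightarrow> pair (pfst j - 1) (child k (psnd j)) \<in> G \<longleftrightarrow> pair (pfst j - 1) (child k (psnd j)) \<in> G'"
  shows "entry X G j k \<longleftrightarrow> entry X G' j k"
  using assms by (auto simp: entry_def node_def)

lemma truthful_bit:
  assumes "truthful X len G t" "\<And>i. i < len \<Longrightarrow> i \<in> G \<longleftrightarrow> i \<in> G'"
  shows "pfst (psnd t) = of_bool (pfst t \<in> real_A X G')"
proof -
  obtain j k where jk: "pfst t = col j k" "pfst (psnd t) = of_bool (entry X G j k)"
    and less: "pfst j \<noteq> 0 \<Longrightarrow>
      pair (pfst j - 1) (psnd j) < len \<and> pair (pfst j - 1) (child k (psnd j)) < len"
    using assms(1) unfolding truthful_def by blast
  have "entry X G j k \<longleftrightarrow> entry X G' j k"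
    by (rule entry_cong) (use less assms(2) in blast)+
  then show ?thesis using jk by simp
qed

text \<open>From \<open>s\<close> on, all correct triples are added. Hence a mistake derived from
  finitely many truthful answers is made with a genuine generic oracle.\<close>

lemma truthful_extends:
  assumes "\<And>t. t < s \<Longrightarrow> t \<in> R \<Longrightarrow> truthful X len G t" "\<And>i. i < len \<Longrightarrow> i \<in> G \<longleftrightarrow> i \<in> G'"
  obtains P where "generic_oracle P (real_A X G')" "\<And>t. t < s \<Longrightarrow> t \<in> R \<longleftrightarrow> t \<in> P"
proof
  let ?P = "{t. if t < s then t \<in> R else pfst (psnd t) = of_bool (pfst t \<in> real_A X G')}"
  show "generic_oracle ?P (real_A X G')"
  proof (rule generic_oracleI[of _ _ "\<lambda>_. 0"])
    show "pfst (psnd t) = of_bool (pfst t \<in> real_A X G')" if "t \<in> ?P" for t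
      using that truthful_bit[OF assms(1) assms(2), of t] by (auto split: if_splits)
    fix j k
    \<comment> \<open>The third component \<open>s\<close> pushes the triple to \<open>s\<close> or
      beyond, where \<open>?P\<close> contains all correct triples.\<close>
    let ?t = "triple (col j k) (of_bool (col j k \<in> real_A X G')) s"
    have "s \<le> ?t"
      unfolding triple_def by (meson le_prod_encode_2 order_trans)
    then have "?t \<in> ?P" by (simp add: triple_def)
    then show "\<exists>l. triple (col j k) (of_bool (col j k \<in> real_A X G')) l \<in> ?P" by blast
  qed
  show "t \<in> R \<longleftrightarrow> t \<in> ?P" if "t < s" for t using that by simp
qed

text \<open>If a witness existed, the construction would have adopted one, and its finite oracle
  would extend to a generic oracle on which \<open>p\<close> gives a wrong bit.\<close>

lemma not_defeated:
  assumes p: "\<And>P. generic_oracle P (real_A X (generic X)) \<Longrightarrow>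
      generic_computation (run p P) (real_B X (generic X))"
  shows "\<not> defeated X (code p) (stage X (code p)) w"
proof
  let ?e = "code p"
  assume "defeated X ?e (stage X ?e) w"
  then have w: "defeated X ?e (stage X ?e) (witness X ?e (stage X ?e))"
    by (rule defeated_witness)
  define len' Q' where "len' = pfst (pfst (witness X ?e (stage X ?e)))"
    and "Q' = psnd (pfst (witness X ?e (stage X ?e)))"
  have "\<exists>w. defeated X ?e (stage X ?e) w"
    using w by blast
  then have stage: "stage X (Suc ?e) = pair (Suc len') Q'"
    unfolding len'_def Q'_def by (simp only: stage_Suc if_True)
  have agree: "i \<in> set (list_decode Q') \<longleftrightarrow> i \<in> generic X" if "i < len'" for i
    using generic_iff[of i X "Suc ?e"] that by (simp add: stage)
  obtain s R d n k v where R: "\<And>t. t < s \<Longrightarrow> t \<in> set (list_decode R) \<Longrightarrow> truthful X len' (set (list_decode Q')) t"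
    and d: "derivation (finite_answer s R) (list_decode d)" "claim ?e (col n k) v \<in> set (list_decode d)"
    and n: "pair n 0 < len'" and v: "v \<noteq> of_bool (node X (set (list_decode Q')) n 0)"
    using w unfolding defeated_def defeat_def len'_def Q'_def by blast
  obtain P where P: "generic_oracle P (real_A X (generic X))"
    and sP: "\<And>t. t < s \<Longrightarrow> t \<in> set (list_decode R) \<longleftrightarrow> t \<in> P"
    using truthful_extends[OF R agree] by blast
  have run: "run p P (col n k) = Some v"
    using finite_derivation_sound[OF d sP] .
  have "run p P (col n k) = Some (if col n k \<in> real_B X (generic X) then 1 else 0)"
    using p[OF P] run unfolding generic_computation_def by blast
  then have "v = of_bool (node X (generic X) n 0)" using run by simp
  moreover have "node X (generic X) n 0 \<longleftrightarrow> node X (set (list_decode Q')) n 0"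
    using agree[OF n] by (simp add: node_def)
  ultimately show False using v by simp
qed

text \<open>
  The oracle that hides, in the column of each node \<open>u\<close>, the children below the path \<open>z\<close> does not
  notice if the bits of all nodes above \<open>z\<close> are flipped simultaneously.
\<close>

definition above :: "(nat \<Rightarrow> nat) \<Rightarrow> nat \<Rightarrow> bool" where
  "above z u \<longleftrightarrow> list_all2 (\<le>) (map z [0..<length (list_decode u)]) (rev (list_decode u))"

lemma list_decode_child [simp]: "list_decode (child k u) = k # list_decode u"
  by (metis list_decode_inverse list_encode.simps(2) list_encode_inverse)

lemma above_0 [simp]: "above z 0"
  by (simp add: above_def)

lemma above_child: "above z (child k u) \<longleftrightarrow> above z u \<and> z (length (list_decode u)) \<le> k"
  by (simp add: above_def list_all2_append)

lemma above_imp_alive: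
  assumes "\<And>i. map z [0..<i] \<in> T" "above z u"
  shows "alive (tree_code T) u"
  using assms unfolding alive_def above_def tree_code_def by blast

definition flip :: "(nat \<Rightarrow> nat) \<Rightarrow> nat \<Rightarrow> nat set \<Rightarrow> nat set" where
  "flip z n G = {i. (i \<in> G) \<noteq> (pfst i = n \<and> above z (psnd i))}"

text \<open>The two ends of a visible edge are both above \<open>z\<close> or both not, so their
  labels change together or not at all. As nodes above \<open>z\<close> are alive, flipping a bit
  there does flip the label.\<close>

lemma entry_flip:
  assumes "\<And>i. map z [0..<i] \<in> T" "pfst j = 0 \<or> z (length (list_decode (psnd j))) \<le> k"
  shows "entry (tree_code T) (flip z n G) j k \<longleftrightarrow> entry (tree_code T) G j k"
proof (cases "pfst j = 0")
  case False
  then have "above z (child k (psnd j)) \<longleftrightarrow> above z (psnd j)"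
    using assms(2) above_child by simp
  moreover have "above z u \<Longrightarrow> alive (tree_code T) u" for u
    using above_imp_alive[OF assms(1)] .
  ultimately show ?thesis
    using False by (auto simp: entry_def node_def flip_def)
qed (simp add: entry_def)

lemma node_flip:
  assumes "\<And>i. map z [0..<i] \<in> T"
  shows "node (tree_code T) (flip z n G) n 0 \<longleftrightarrow> \<not> node (tree_code T) G n 0"
  using above_imp_alive[OF assms above_0] by (auto simp: node_def flip_def)

text \<open>Flipping changes a root bit but no visible answer, so a computation from the visible
  oracle supplies a witness for defeating \<open>p\<close>, against
  \<open>not_defeated\<close>.\<close>

theorem ill_founded_imp_not_generic_ge:
  assumes "\<not> well_founded_tree T"
  shows "\<not> real_A (tree_code T) (generic (tree_code T)) \<ge>\<^sub>g real_B (tree_code T) (generic (tree_code T))"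
proof
  let ?X = "tree_code T" and ?G = "generic (tree_code T)"
  let ?A = "real_A ?X ?G" and ?B = "real_B ?X ?G"
  assume "?A \<ge>\<^sub>g ?B"
  then obtain p where p: "\<And>P. generic_oracle P ?A \<Longrightarrow> generic_computation (run p P) ?B"
    unfolding generic_ge_def by blast
  obtain z where z: "\<And>i. map z [0..<i] \<in> T"
    using assms unfolding well_founded_tree_def by blast
  \<comment> \<open>Despite the name, this describes the visible positions: those about aliveness,
    and the edges to children not below the path \<open>z\<close>.\<close>
  let ?hidden = "\<lambda>j k. pfst j = 0 \<or> z (length (list_decode (psnd j))) \<le> k"
  define P where "P = {t. pfst (psnd t) = of_bool (pfst t \<in> ?A) \<and> (\<exists>j k. pfst t = col j k \<and> ?hidden j k)}"
  have "generic_oracle P ?A"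
  proof (rule generic_oracleI[of _ _ "\<lambda>j. z (length (list_decode (psnd j)))"])
    fix j k assume "z (length (list_decode (psnd j))) \<le> k"
    then have "triple (col j k) (of_bool (col j k \<in> ?A)) 0 \<in> P"
      by (simp add: P_def triple_def)
    then show "\<exists>l. triple (col j k) (of_bool (col j k \<in> ?A)) l \<in> P" ..
  qed (simp add: P_def)
  from p[OF this] have comp: "generic_computation (run p P) ?B" .
  let ?st = "stage ?X (code p)"
  \<comment> \<open>The indices of the bits for this \<open>n\<close> are at least \<open>n\<close>,
    the length of the current string, so flipping them leaves the string intact.\<close>
  define n where "n = pfst ?st"
  have "density_1 (dom (run p P))" using comp unfolding generic_computation_def by blast
  then obtain k where "col n k \<in> dom (run p P)" using density_1_meets_column by blast
  then have run: "run p P (col n k) = Some (of_bool (node ?X ?G n 0))"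
    using comp unfolding generic_computation_def by auto
  obtain s d where sd: "\<And>Q. (\<And>t. t < s \<Longrightarrow> t \<in> set (list_decode Q) \<longleftrightarrow> t \<in> P) \<Longrightarrow>
      derivation (finite_answer s Q) (list_decode d) \<and>
      claim (code p) (col n k) (of_bool (node ?X ?G n 0)) \<in> set (list_decode d)"
    using finite_derivation[OF run] by blast
  obtain R where R: "set (list_decode R) = P \<inter> {..<s}"
    using ex_code_of_finite[of "P \<inter> {..<s}"] by auto
  let ?G' = "flip z n ?G"
  \<comment> \<open>\<open>len'\<close> must exceed \<open>n\<close>, the index of the root's bit,
    and the indices of all bits that decide positions occurring in triples below
    \<open>s\<close>.\<close>
  let ?F = "{n, pair n 0} \<union> (\<lambda>j. pair (pfst j - 1) (psnd j)) ` {..s} \<union>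
    (\<lambda>(j, k). pair (pfst j - 1) (child k (psnd j))) ` ({..s} \<times> {..s})"
  have "finite ?F" by simp
  then obtain len' where len': "\<And>i. i \<in> ?F \<Longrightarrow> i < len'"
    using finite_nat_set_iff_bounded[of ?F] by blast
  obtain Q' where Q': "set (list_decode Q') = ?G' \<inter> {..<len'}"
    using ex_code_of_finite[of "?G' \<inter> {..<len'}"] by auto
  \<comment> \<open>The computed value is right for \<open>?G\<close>, hence wrong for the string
    \<open>Q'\<close> cut from the flipped set.\<close>
  have "defeat ?X (code p) (pfst ?st) (psnd ?st) len' Q' s R d n k (of_bool (node ?X ?G n 0))"
    unfolding defeat_def
  proof (intro conjI allI impI)
    show "pfst ?st \<le> len'" using len'[of n] by (simp add: n_def)
    fix i assume i: "i < pfst ?st"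
    then have "pfst i \<noteq> n" using le_prod_encode_1[of "pfst i" "psnd i"] by (simp add: n_def)
    then have "i \<in> ?G' \<longleftrightarrow> i \<in> ?G" by (simp add: flip_def)
    then show "i \<in> set (list_decode Q') \<longleftrightarrow> i \<in> set (list_decode (psnd ?st))"
      using i \<open>pfst ?st \<le> len'\<close> generic_iff[OF i] by (simp add: Q')
  next
    fix t assume "t < s" "t \<in> set (list_decode R)"
    then obtain j k where t: "pfst (psnd t) = of_bool (pfst t \<in> ?A)" "pfst t = col j k" "?hidden j k"
      unfolding R P_def by blast
    have "pfst t \<le> t"
      using le_prod_encode_1[of "pfst t" "psnd t"] by (simp only: pair_pfst_psnd)
    then have le: "pfst t \<le> s" "j \<le> pfst t" "k \<le> pfst t"
      using \<open>t < s\<close> le_col_1[of j k] le_col_2[of k j] t(2) by simp_all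
    have "pair (pfst j - 1) (psnd j) \<in> (\<lambda>j. pair (pfst j - 1) (psnd j)) ` {..s}"
      using le by (intro image_eqI[of _ _ j]) simp_all
    moreover have "pair (pfst j - 1) (child k (psnd j)) \<in>
        (\<lambda>(j, k). pair (pfst j - 1) (child k (psnd j))) ` ({..s} \<times> {..s})"
      using le by (intro image_eqI[of _ _ "(j, k)"]) simp_all
    ultimately have less: "pair (pfst j - 1) (psnd j) < len'" "pair (pfst j - 1) (child k (psnd j)) < len'"
      by (blast intro: len')+
    have "entry ?X (set (list_decode Q')) j k \<longleftrightarrow> entry ?X ?G' j k"
      by (rule entry_cong) (use less in \<open>simp_all add: Q'\<close>)
    also have "\<dots> \<longleftrightarrow> entry ?X ?G j k"
      using z t(3) by (rule entry_flip)
    finally show "truthful ?X len' (set (list_decode Q')) t"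
      unfolding truthful_def using le less t by (intro exI[of _ j] exI[of _ k]) simp
  next
    show "derivation (finite_answer s R) (list_decode d)"
      "claim (code p) (col n k) (of_bool (node ?X ?G n 0)) \<in> set (list_decode d)"
      using sd[of R] by (simp_all add: R)
    show "pair n 0 < len'" using len' by simp
    then have "node ?X (set (list_decode Q')) n 0 \<longleftrightarrow> node ?X ?G' n 0"
      by (simp add: node_def Q')
    then show "of_bool (node ?X ?G n 0) \<noteq> (of_bool (node ?X (set (list_decode Q')) n 0) :: nat)"
      using node_flip[OF z] by simp
  qed
  then have "defeated ?X (code p) ?st
      (pair (pair len' Q') (pair (pair s R) (pair d (pair n (pair k (of_bool (node ?X ?G n 0)))))))"
    by (simp add: defeated_def)
  then show False using not_defeated[OF p] by blast
qed

theorem generic_ge_iff_well_founded: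
  assumes "is_tree T"
  shows "real_A (tree_code T) (generic (tree_code T)) \<ge>\<^sub>g real_B (tree_code T) (generic (tree_code T)) \<longleftrightarrow>
    well_founded_tree T"
  using well_founded_imp_generic_ge[OF assms] ill_founded_imp_not_generic_ge by blast

section \<open>Measurability of functionals\<close>

lemma pred_constant: "Measurable.pred M (\<lambda>y. c)"
  by simp

text \<open>The initial segment has only finitely many possible values, so any property of it is a
  finite combination of statements about single bits.\<close>

lemma pred_initial_segment:
  assumes [measurable]: "\<And>n. Measurable.pred M (\<lambda>y. n \<in> h y)"
  shows "Measurable.pred M (\<lambda>y. R (h y \<inter> {..<s::nat}))"
proof -
  have "R (h y \<inter> {..<s}) \<longleftrightarrow>
      (\<exists>F\<in>{F \<in> Pow {..<s}. R F}. \<forall>i\<in>{..<s}. i \<in> h y \<longleftrightarrow> i \<in> F)" for y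
  proof
    assume "R (h y \<inter> {..<s})"
    then show "\<exists>F\<in>{F \<in> Pow {..<s}. R F}. \<forall>i\<in>{..<s}. i \<in> h y \<longleftrightarrow> i \<in> F"
      by (intro bexI[of _ "h y \<inter> {..<s}"]) auto
  next
    assume "\<exists>F\<in>{F \<in> Pow {..<s}. R F}. \<forall>i\<in>{..<s}. i \<in> h y \<longleftrightarrow> i \<in> F"
    then obtain F where "F \<subseteq> {..<s}" "R F" "\<forall>i\<in>{..<s}. i \<in> h y \<longleftrightarrow> i \<in> F" by blast
    moreover from this have "h y \<inter> {..<s} = F" by blast
    ultimately show "R (h y \<inter> {..<s})" by simp
  qed
  moreover have "Measurable.pred M (\<lambda>y. \<exists>F\<in>{F \<in> Pow {..<s}. R F}. \<forall>i\<in>{..<s}. i \<in> h y \<longleftrightarrow> i \<in> F)"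
    by (intro pred_intros_finite pred_intros_logic(6) pred_constant assms) auto
  ultimately show ?thesis by simp
qed

text \<open>By the use principle, halting with value \<open>v\<close> is a countable union of
  conditions on initial segments.\<close>

lemma pred_run:
  assumes [measurable]: "\<And>n. Measurable.pred M (\<lambda>y. n \<in> h y)"
  shows "Measurable.pred M (\<lambda>y. run p (h y) x = Some v)"
proof -
  have "run p (h y) x = Some v \<longleftrightarrow>
      (\<exists>s. \<forall>Y. Y \<inter> {..<s} = h y \<inter> {..<s} \<longrightarrow> run p Y x = Some v)" for y
    using run_use by metis
  moreover have "Measurable.pred M (\<lambda>y. \<exists>s. \<forall>Y. Y \<inter> {..<s} = h y \<inter> {..<s} \<longrightarrow> run p Y x = Some v)"
    by (intro pred_intros_countable pred_initial_segment[OF assms])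
  ultimately show ?thesis by simp
qed

lemma pred_dom_run:
  assumes "\<And>n. Measurable.pred M (\<lambda>y. n \<in> h y)"
  shows "Measurable.pred M (\<lambda>y. x \<in> dom (run p (h y)))"
  unfolding domIff not_None_eq by (intro pred_intros_countable pred_run[OF assms])

lemma pred_jump:
  assumes "\<And>n. Measurable.pred M (\<lambda>y. n \<in> h y)"
  shows "Measurable.pred M (\<lambda>y. n \<in> jump (h y))"
proof (cases "\<exists>p. n = code p")
  case True
  then obtain p where "n = code p" by blast
  then have "n \<in> jump (h y) \<longleftrightarrow> n \<in> dom (run p (h y))" for y
    using inj_code by (auto simp: jump_def inj_eq)
  then show ?thesis using pred_dom_run[OF assms] by simp
next
  case False
  then show ?thesis by (auto simp: jump_def)
qed

lemma pred_density_1: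
  assumes "\<And>n. Measurable.pred M (\<lambda>y. n \<in> h y)"
  shows "Measurable.pred M (\<lambda>y. density_1 (h y))"
proof -
  \<comment> \<open>Countably many tolerances suffice, which keeps all quantifiers
    countable.\<close>
  have "X \<longlonglongrightarrow> (1::real) \<longleftrightarrow> (\<forall>k. \<exists>N. \<forall>n. N \<le> n \<longrightarrow> \<bar>X n - 1\<bar> < inverse (real (Suc k)))" for X
  proof
    assume "X \<longlonglongrightarrow> 1"
    then show "\<forall>k. \<exists>N. \<forall>n. N \<le> n \<longrightarrow> \<bar>X n - 1\<bar> < inverse (real (Suc k))"
      unfolding lim_sequentially dist_real_def by simp
  next
    assume *: "\<forall>k. \<exists>N. \<forall>n. N \<le> n \<longrightarrow> \<bar>X n - 1\<bar> < inverse (real (Suc k))"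
    show "X \<longlonglongrightarrow> 1"
      unfolding lim_sequentially dist_real_def
    proof (intro allI impI)
      fix r :: real assume "r > 0"
      then obtain k where "inverse (real (Suc k)) < r" using reals_Archimedean by blast
      then show "\<exists>N. \<forall>n\<ge>N. \<bar>X n - 1\<bar> < r" using * by (meson order_less_trans)
    qed
  qed
  then have eq: "density_1 (h y) \<longleftrightarrow> (\<forall>k. \<exists>N. \<forall>n. N \<le> n \<longrightarrow>
      \<bar>real (card (h y \<inter> {..<n})) / real n - 1\<bar> < inverse (real (Suc k)))" for y
    unfolding density_1_def by simp
  have "Measurable.pred M (\<lambda>y. \<bar>real (card (h y \<inter> {..<n})) / real n - 1\<bar> < inverse (real (Suc k)))"
    for n k
    by (rule pred_initial_segment[OF assms,
          where R="\<lambda>F. \<bar>real (card F) / real n - 1\<bar> < inverse (real (Suc k))"])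
  note segment = this
  show ?thesis
    unfolding eq by (intro pred_intros_countable pred_intros_imp' segment)
qed

lemma pred_generic_oracle:
  assumes "\<And>n. Measurable.pred M (\<lambda>y. n \<in> P y)" "\<And>n. Measurable.pred M (\<lambda>y. n \<in> C y)"
  shows "Measurable.pred M (\<lambda>y. generic_oracle (P y) (C y))"
proof -
  have "Measurable.pred M (\<lambda>y. n \<in> oracle_dom (P y))" for n
    unfolding oracle_dom_def mem_Collect_eq by (intro pred_intros_countable assms)
  then show ?thesis
    unfolding generic_oracle_def partial_oracle_def
    by (intro pred_intros_countable pred_intros_logic(2-6) pred_constant pred_density_1 assms)
qed

lemma pred_generic_computation:
  assumes "\<And>n. Measurable.pred M (\<lambda>y. n \<in> P y)" "\<And>n. Measurable.pred M (\<lambda>y. n \<in> D y)"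
  shows "Measurable.pred M (\<lambda>y. generic_computation (run p (P y)) (D y))"
proof -
  have "ran f \<subseteq> {0, 1} \<and> (\<forall>n\<in>dom f. f n = Some (if n \<in> E then 1 else 0)) \<longleftrightarrow>
      (\<forall>n v. f n = Some v \<longrightarrow> (n \<in> E \<longrightarrow> v = 1) \<and> (n \<notin> E \<longrightarrow> v = 0))" for f :: "nat \<rightharpoonup> nat" and E
    by (force simp: ran_def dom_def)
  then show ?thesis
    unfolding generic_computation_def
    by (simp only:) (intro pred_intros_countable pred_intros_logic(2-6) pred_constant pred_density_1 pred_dom_run pred_run assms)
qed

section \<open>Analytic sets\<close>

lemma topspace_baire [simp]: "topspace baire_space = UNIV"
  by (simp add: baire_space_def)

lemma topspace_cantor [simp]: "topspace cantor_space = UNIV"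
  by (simp add: cantor_space_def topspace_pullback_topology)

lemma continuous_map_baire_coordinate: "continuous_map baire_space (discrete_topology UNIV) (\<lambda>z. z n)"
  unfolding baire_space_def by (rule continuous_map_product_projection) simp

lemma continuous_map_cantor_coordinate: "continuous_map cantor_space (discrete_topology UNIV) (\<lambda>A. n \<in> A)"
proof -
  have "continuous_map (product_topology (\<lambda>_. discrete_topology (UNIV :: bool set)) UNIV)
      (discrete_topology UNIV) (\<lambda>f. f n)"
    by (rule continuous_map_product_projection) simp
  from continuous_map_pullback[OF this, of UNIV "\<lambda>A n. n \<in> A"]
  show ?thesis by (simp add: cantor_space_def comp_def)
qed

text \<open>Several witnesses will be merged into one sequence; reindexing recovers each of them
  continuously.\<close>

lemma continuous_map_reindex:
  "continuous_map (prod_topology X baire_space) (prod_topology X baire_space) (\<lambda>w. (fst w, \<lambda>k. snd w (f k)))"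
proof -
  have "continuous_map (prod_topology X baire_space) baire_space (\<lambda>w k. snd w (f k))"
    unfolding baire_space_def continuous_map_componentwise_UNIV
    using continuous_map_compose[OF continuous_map_snd[of X baire_space] continuous_map_baire_coordinate]
    by (simp add: comp_def baire_space_def)
  then show ?thesis by (simp add: continuous_map_pairedI continuous_map_fst)
qed

section \<open>Closure properties of analytic sets\<close>

lemma Sigma11_closed:
  assumes "closedin X A"
  shows "Sigma11 X A"
  unfolding Sigma11_def
proof (intro exI conjI)
  show "closedin (prod_topology X baire_space) (A \<times> UNIV)"
    using assms closedin_topspace[of baire_space] by (simp add: closedin_prod_Times_iff)
qed auto

lemma Sigma11E:
  assumes "Sigma11 X A"
  obtains F where "closedin (prod_topology X baire_space) F" "\<And>x. x \<in> A \<longleftrightarrow> (\<exists>z. (x, z) \<in> F)"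
  using assms unfolding Sigma11_def by force

lemma Sigma11I:
  assumes "closedin (prod_topology X baire_space) F" "\<And>x. x \<in> A \<longleftrightarrow> (\<exists>z. (x, z) \<in> F)"
  shows "Sigma11 X A"
  unfolding Sigma11_def using assms by (intro exI[of _ F]) force

lemma Sigma11_subset_topspace: "Sigma11 X A \<Longrightarrow> A \<subseteq> topspace X"
  by (elim Sigma11E) (auto dest!: closedin_subset)

text \<open>Countably many witnesses are merged into one by means of \<open>pair\<close>.\<close>

lemma Sigma11_INT:
  assumes "\<And>n::nat. Sigma11 X (A n)"
  shows "Sigma11 X (\<Inter>n. A n)"
proof -
  have "\<exists>F. closedin (prod_topology X baire_space) F \<and> (\<forall>x. x \<in> A n \<longleftrightarrow> (\<exists>z. (x, z) \<in> F))" for n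
    using Sigma11E[OF assms] by metis
  then obtain F where F: "\<And>n. closedin (prod_topology X baire_space) (F n)"
    and A: "\<And>n x. x \<in> A n \<longleftrightarrow> (\<exists>z. (x, z) \<in> F n)"
    by metis
  let ?g = "\<lambda>n (w :: _ \<times> (nat \<Rightarrow> nat)). (fst w, \<lambda>k. snd w (pair n k))"
  let ?G = "\<Inter>n. {w \<in> topspace (prod_topology X baire_space). ?g n w \<in> F n}"
  show ?thesis
  proof (rule Sigma11I)
    show "closedin (prod_topology X baire_space) ?G"
      by (intro closedin_INT closedin_continuous_map_preimage[OF continuous_map_reindex] F) simp
    show "x \<in> (\<Inter>n. A n) \<longleftrightarrow> (\<exists>z. (x, z) \<in> ?G)" for x
    proof
      assume x: "x \<in> (\<Inter>n. A n)"
      then obtain z where z: "\<And>n. (x, z n) \<in> F n" using A by simp metis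
      have "x \<in> topspace X" using x Sigma11_subset_topspace[OF assms] by blast
      then have "(x, \<lambda>m. z (pfst m) (psnd m)) \<in> ?G" using z by simp
      then show "\<exists>z. (x, z) \<in> ?G" by (intro exI)
    next
      assume "\<exists>z. (x, z) \<in> ?G"
      then obtain z where "\<And>n. (x, \<lambda>k. z (pair n k)) \<in> F n" by auto
      then show "x \<in> (\<Inter>n. A n)" using A by blast
    qed
  qed
qed

text \<open>The first value of the new witness names a set of the family, the remaining values are a
  witness for it.\<close>

lemma Sigma11_UN:
  assumes "\<And>n::nat. Sigma11 X (A n)"
  shows "Sigma11 X (\<Union>n. A n)"
proof -
  have "\<exists>F. closedin (prod_topology X baire_space) F \<and> (\<forall>x. x \<in> A n \<longleftrightarrow> (\<exists>z. (x, z) \<in> F))" for n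
    using Sigma11E[OF assms] by metis
  then obtain F where F: "\<And>n. closedin (prod_topology X baire_space) (F n)"
    and A: "\<And>n x. x \<in> A n \<longleftrightarrow> (\<exists>z. (x, z) \<in> F n)"
    by metis
  let ?T = "topspace (prod_topology X baire_space)"
  let ?g = "\<lambda>w :: _ \<times> (nat \<Rightarrow> nat). (fst w, \<lambda>k. snd w (Suc k))"
  \<comment> \<open>The implication from \<open>snd w 0 = n\<close> to
    \<open>?g w \<in> F n\<close>, written as a union of closed sets.\<close>
  let ?G = "\<Inter>n. {w \<in> ?T. snd w 0 \<in> - {n}} \<union> {w \<in> ?T. ?g w \<in> F n}"
  show ?thesis
  proof (rule Sigma11I)
    have "continuous_map (prod_topology X baire_space) (discrete_topology UNIV) (\<lambda>w. snd w 0)"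
      using continuous_map_compose[OF continuous_map_snd[of X baire_space] continuous_map_baire_coordinate]
      by (simp add: comp_def)
    then show "closedin (prod_topology X baire_space) ?G"
      by (intro closedin_INT closedin_Un closedin_continuous_map_preimage[OF continuous_map_reindex] F
          closedin_continuous_map_preimage[where f="\<lambda>w. snd w 0"]) auto
    show "x \<in> (\<Union>n. A n) \<longleftrightarrow> (\<exists>z. (x, z) \<in> ?G)" for x
    proof
      assume "x \<in> (\<Union>n. A n)"
      then obtain n z where z: "x \<in> A n" "(x, z) \<in> F n" using A by blast
      then have "x \<in> topspace X" using Sigma11_subset_topspace[OF assms] by blast
      then have "(x, \<lambda>k. case k of 0 \<Rightarrow> n | Suc k \<Rightarrow> z k) \<in> ?G" using z by simp
      then show "\<exists>z. (x, z) \<in> ?G" by (intro exI)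
    next
      assume "\<exists>z. (x, z) \<in> ?G"
      then obtain z where "(x, z) \<in> ?G" ..
      then have "(x, \<lambda>k. z (Suc k)) \<in> F (z 0)" by simp blast
      then show "x \<in> (\<Union>n. A n)" using A by blast
    qed
  qed
qed

text \<open>The point projected away and the old witness are interleaved on even and odd
  positions.\<close>

lemma Sigma11_fst:
  assumes "Sigma11 (prod_topology X baire_space) A"
  shows "Sigma11 X (fst ` A)"
proof -
  obtain F where F: "closedin (prod_topology (prod_topology X baire_space) baire_space) F"
    and A: "\<And>x. x \<in> A \<longleftrightarrow> (\<exists>z. (x, z) \<in> F)"
    using Sigma11E[OF assms] by blast
  let ?g = "\<lambda>w :: _ \<times> (nat \<Rightarrow> nat). ((fst w, \<lambda>k. snd w (2 * k)), \<lambda>k. snd w (2 * k + 1))"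
  let ?G = "{w \<in> topspace (prod_topology X baire_space). ?g w \<in> F}"
  show ?thesis
  proof (rule Sigma11I)
    have "continuous_map (prod_topology X baire_space) baire_space (\<lambda>w k. snd w (2 * k + 1))"
      using continuous_map_compose[OF continuous_map_reindex continuous_map_snd, of X "\<lambda>k. 2 * k + 1"]
      by (simp add: comp_def)
    then have "continuous_map (prod_topology X baire_space)
        (prod_topology (prod_topology X baire_space) baire_space) ?g"
      by (intro continuous_map_pairedI continuous_map_reindex)
    then show "closedin (prod_topology X baire_space) ?G"
      by (rule closedin_continuous_map_preimage) (rule F)
    show "x \<in> fst ` A \<longleftrightarrow> (\<exists>z. (x, z) \<in> ?G)" for x
    proof
      assume "x \<in> fst ` A"
      then obtain y z where yz: "((x, y), z) \<in> F" using A by force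
      then have "x \<in> topspace X" using closedin_subset[OF F] by auto
      then have "(x, \<lambda>k. if even k then y (k div 2) else z (k div 2)) \<in> ?G" using yz by simp
      then show "\<exists>z. (x, z) \<in> ?G" by (intro exI)
    next
      assume "\<exists>z. (x, z) \<in> ?G"
      then show "x \<in> fst ` A" using A by force
    qed
  qed
qed

text \<open>The class Delta^1_1. As it is a \<sigma>-algebra, the measurability results for
  functionals apply to it and thereby yield analytic sets.\<close>

definition bianalytic :: "'a topology \<Rightarrow> 'a set set" where
  "bianalytic X = {S. S \<subseteq> topspace X \<and> Sigma11 X S \<and> Sigma11 X (topspace X - S)}"

lemma sigma_algebra_bianalytic: "sigma_algebra (topspace X) (bianalytic X)"
  unfolding sigma_algebra_iff2
proof (intro conjI ballI allI impI)
  show "bianalytic X \<subseteq> Pow (topspace X)" by (auto simp: bianalytic_def)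
  show "{} \<in> bianalytic X" by (simp add: bianalytic_def Sigma11_closed)
  show "topspace X - S \<in> bianalytic X" if "S \<in> bianalytic X" for S
    using that by (auto simp: bianalytic_def double_diff)
  show "(\<Union>i. A i) \<in> bianalytic X" if "range A \<subseteq> bianalytic X" for A :: "nat \<Rightarrow> _"
  proof -
    have "topspace X - (\<Union>i. A i) = (\<Inter>i. topspace X - A i)" by auto
    moreover have "Sigma11 X (\<Union>i. A i)"
      by (rule Sigma11_UN) (use that in \<open>auto simp: bianalytic_def\<close>)
    moreover have "Sigma11 X (\<Inter>i. topspace X - A i)"
      by (rule Sigma11_INT) (use that in \<open>auto simp: bianalytic_def\<close>)
    ultimately show ?thesis
      using that by (auto simp: bianalytic_def image_subset_iff)
  qed
qed

lemma space_sigma_bianalytic: "space (sigma (topspace X) (bianalytic X)) = topspace X"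
  and sets_sigma_bianalytic: "sets (sigma (topspace X) (bianalytic X)) = bianalytic X"
  using sigma_algebra.sigma_sets_eq[OF sigma_algebra_bianalytic, of X]
  by (auto simp: bianalytic_def space_measure_of_conv sets_measure_of_conv)

lemma pred_bianalytic_clopen:
  assumes "continuous_map X (discrete_topology UNIV) Q"
  shows "Measurable.pred (sigma (topspace X) (bianalytic X)) Q"
proof -
  have "closedin X {x \<in> topspace X. Q x \<in> {True}}" "closedin X {x \<in> topspace X. Q x \<in> {False}}"
    by (rule closedin_continuous_map_preimage[OF assms], simp)+
  moreover have "topspace X - {x \<in> topspace X. Q x} = {x \<in> topspace X. \<not> Q x}" by blast
  ultimately have "{x \<in> topspace X. Q x} \<in> bianalytic X"
    by (simp add: bianalytic_def Sigma11_closed)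
  then show ?thesis
    unfolding pred_def space_sigma_bianalytic sets_sigma_bianalytic .
qed

text \<open>The complement says that each functional fails on some generic oracle: a countable
  intersection of projections of bianalytic sets.\<close>

lemma Pi11_generic_ge:
  "Pi11 (prod_topology cantor_space cantor_space) {(A, B). A \<ge>\<^sub>g B}"
proof -
  let ?C = "prod_topology cantor_space cantor_space"
  let ?X = "prod_topology ?C baire_space"
  let ?M = "sigma (topspace ?X) (bianalytic ?X)"
  \<comment> \<open>An oracle is represented as the set of zeros of a point of Baire space.\<close>
  let ?P = "\<lambda>w :: (nat set \<times> nat set) \<times> (nat \<Rightarrow> nat). {n. snd w n = 0}"
  let ?Q = "\<lambda>p w. generic_oracle (?P w) (fst (fst w)) \<and> \<not> generic_computation (run p (?P w)) (snd (fst w))"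
  have C: "continuous_map ?X ?C fst" by (rule continuous_map_fst)
  have A: "Measurable.pred ?M (\<lambda>w. n \<in> fst (fst w))" for n
    using continuous_map_compose[OF continuous_map_compose[OF C continuous_map_fst]
        continuous_map_cantor_coordinate[of n]]
    by (intro pred_bianalytic_clopen) (simp add: comp_def)
  have B: "Measurable.pred ?M (\<lambda>w. n \<in> snd (fst w))" for n
    using continuous_map_compose[OF continuous_map_compose[OF C continuous_map_snd]
        continuous_map_cantor_coordinate[of n]]
    by (intro pred_bianalytic_clopen) (simp add: comp_def)
  have P: "Measurable.pred ?M (\<lambda>w. n \<in> ?P w)" for n
  proof (rule pred_bianalytic_clopen)
    have "continuous_map (discrete_topology UNIV) (discrete_topology UNIV) (\<lambda>k::nat. k = 0)"
      by simp
    from continuous_map_compose[OF continuous_map_compose[OF continuous_map_snd[of ?C baire_space]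
          continuous_map_baire_coordinate[of n]] this]
    show "continuous_map ?X (discrete_topology UNIV) (\<lambda>w. n \<in> ?P w)" by (simp add: comp_def)
  qed
  have "Measurable.pred ?M (?Q p)" for p
    by (intro pred_intros_logic(2-6) pred_generic_oracle pred_generic_computation A B P)
  then have "{w \<in> topspace ?X. ?Q p w} \<in> bianalytic ?X" for p
    unfolding pred_def space_sigma_bianalytic sets_sigma_bianalytic .
  then have "Sigma11 ?C (fst ` {w \<in> topspace ?X. ?Q p w})" for p
    by (intro Sigma11_fst) (simp add: bianalytic_def)
  \<comment> \<open>Every functional is \<open>inv code n\<close> for some \<open>n\<close>, so a
    countable intersection covers all of them.\<close>
  then have "Sigma11 ?C (\<Inter>n. fst ` {w \<in> topspace ?X. ?Q (inv code n) w})"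
    by (rule Sigma11_INT)
  moreover have "(\<Inter>n. fst ` {w \<in> topspace ?X. ?Q (inv code n) w}) = topspace ?C - {(A, B). A \<ge>\<^sub>g B}"
  proof -
    have "(A, B) \<in> (\<Inter>n. fst ` {w \<in> topspace ?X. ?Q (inv code n) w}) \<longleftrightarrow> \<not> A \<ge>\<^sub>g B" for A B
    proof -
      have "(A, B) \<in> fst ` {w \<in> topspace ?X. ?Q p w} \<longleftrightarrow>
          (\<exists>P. generic_oracle P A \<and> \<not> generic_computation (run p P) B)" for p
      proof
        assume "(A, B) \<in> fst ` {w \<in> topspace ?X. ?Q p w}"
        then show "\<exists>P. generic_oracle P A \<and> \<not> generic_computation (run p P) B" by auto
      next
        assume "\<exists>P. generic_oracle P A \<and> \<not> generic_computation (run p P) B"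
        then obtain P where "generic_oracle P A" "\<not> generic_computation (run p P) B" by blast
        moreover have "{n. (if n \<in> P then 0 else 1 :: nat) = 0} = P" by auto
        ultimately have "((A, B), \<lambda>n. if n \<in> P then 0 else 1) \<in> {w \<in> topspace ?X. ?Q p w}"
          by simp
        then show "(A, B) \<in> fst ` {w \<in> topspace ?X. ?Q p w}" by (rule rev_image_eqI) simp
      qed
      then have "(A, B) \<in> (\<Inter>n. fst ` {w \<in> topspace ?X. ?Q (inv code n) w}) \<longleftrightarrow>
          (\<forall>n. \<exists>P. generic_oracle P A \<and> \<not> generic_computation (run (inv code n) P) B)"
        by simp
      also have "\<dots> \<longleftrightarrow> (\<forall>p. \<exists>P. generic_oracle P A \<and> \<not> generic_computation (run p P) B)"
        using inv_f_f[OF inj_code] by metis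
      finally show ?thesis unfolding generic_ge_def by blast
    qed
    then show ?thesis by auto
  qed
  ultimately show ?thesis unfolding Pi11_def by simp
qed

section \<open>Reduction of coanalytic sets\<close>

lemma openin_discrete_product:
  assumes "openin (product_topology (\<lambda>_::nat. discrete_topology UNIV) UNIV) U" "f \<in> U"
  obtains s where "\<And>g. (\<And>i. i < s \<Longrightarrow> g i = f i) \<Longrightarrow> g \<in> U"
proof -
  obtain V where fin: "finite {i \<in> UNIV. V i \<noteq> topspace (discrete_topology UNIV)}"
    and V: "f \<in> Pi\<^sub>E UNIV V" "Pi\<^sub>E UNIV V \<subseteq> U"
    using assms unfolding openin_product_topology_alt by meson
  obtain s where s: "\<And>i. V i \<noteq> UNIV \<Longrightarrow> i < s"
    using fin finite_nat_set_iff_bounded by auto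
  show thesis
  proof (rule that[of s])
    fix g assume g: "\<And>i. i < s \<Longrightarrow> g i = f i"
    have "g i \<in> V i" for i
      using s[of i] g[of i] V(1) by (cases "V i = UNIV") (auto simp: PiE_UNIV_domain)
    then show "g \<in> U" using V(2) by (auto simp: PiE_UNIV_domain)
  qed
qed

lemma openin_cantor:
  assumes "openin cantor_space U" "A \<in> U"
  obtains s where "\<And>A'. A' \<inter> {..<s} = A \<inter> {..<s} \<Longrightarrow> A' \<in> U"
proof -
  obtain V where V: "openin (product_topology (\<lambda>_. discrete_topology (UNIV :: bool set)) UNIV) V"
    and U: "U = (\<lambda>A n. n \<in> A) -` V"
    using assms(1) unfolding cantor_space_def openin_pullback_topology by auto
  obtain s where s: "\<And>g. (\<And>i. i < s \<Longrightarrow> g i = (i \<in> A)) \<Longrightarrow> g \<in> V"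
    using openin_discrete_product[OF V, of "\<lambda>n. n \<in> A"] assms(2) U by auto
  show thesis
  proof (rule that[of s])
    fix A' assume "A' \<inter> {..<s} = A \<inter> {..<s}"
    then have "\<And>i. i < s \<Longrightarrow> (i \<in> A') = (i \<in> A)" by blast
    then show "A' \<in> U" using s[of "\<lambda>i. i \<in> A'"] by (simp add: U)
  qed
qed

section \<open>Borel maps into the space of pairs of reals\<close>

lemma space_borel_of: "space (borel_of X) = topspace X"
  by (simp add: borel_of_def space_measure_of_conv)

lemma openin_in_borel_of: "openin X U \<Longrightarrow> U \<in> sets (borel_of X)"
  unfolding borel_of_def by (subst sets_measure_of) (auto dest: openin_subset)

lemma measurable_cantor_prod:
  assumes "\<And>n. Measurable.pred M (\<lambda>y. n \<in> f y)" "\<And>n. Measurable.pred M (\<lambda>y. n \<in> g y)"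
  shows "(\<lambda>y. (f y, g y)) \<in> measurable M (borel_of (prod_topology cantor_space cantor_space))"
  unfolding borel_of_def
proof (rule measurable_measure_of)
  fix U assume "U \<in> {U. openin (prod_topology cantor_space cantor_space) U}"
  then have U: "openin (prod_topology cantor_space cantor_space) U" by simp
  let ?R = "\<lambda>s F F'. \<forall>A B. A \<inter> {..<s} = F \<and> B \<inter> {..<s} = F' \<longrightarrow> (A, B) \<in> U"
  \<comment> \<open>Open sets are unions of products of cylinders. Naming the finite segment
    \<open>F\<close> of \<open>f y\<close> splits the condition into one on \<open>f y\<close> and
    one on \<open>g y\<close>.\<close>
  have eq: "(f y, g y) \<in> U \<longleftrightarrow> (\<exists>s. \<exists>F\<in>Pow {..<s}. f y \<inter> {..<s} = F \<and> ?R s F (g y \<inter> {..<s}))" for y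
  proof
    assume "(f y, g y) \<in> U"
    then obtain V W where VW: "openin cantor_space V" "openin cantor_space W" "f y \<in> V" "g y \<in> W" "V \<times> W \<subseteq> U"
      using U unfolding openin_prod_topology_alt by metis
    obtain s where s: "\<And>A. A \<inter> {..<s} = f y \<inter> {..<s} \<Longrightarrow> A \<in> V"
      using openin_cantor[OF VW(1,3)] by blast
    obtain t where t: "\<And>A. A \<inter> {..<t} = g y \<inter> {..<t} \<Longrightarrow> A \<in> W"
      using openin_cantor[OF VW(2,4)] by blast
    have "?R (max s t) (f y \<inter> {..<max s t}) (g y \<inter> {..<max s t})"
    proof (intro allI impI)
      fix A B assume AB: "A \<inter> {..<max s t} = f y \<inter> {..<max s t} \<and> B \<inter> {..<max s t} = g y \<inter> {..<max s t}"
      have "C \<inter> {..<s} = C \<inter> {..<max s t} \<inter> {..<s}" "C \<inter> {..<t} = C \<inter> {..<max s t} \<inter> {..<t}" for C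
        by auto
      then have "A \<inter> {..<s} = f y \<inter> {..<s}" "B \<inter> {..<t} = g y \<inter> {..<t}"
        using AB by metis+
      then show "(A, B) \<in> U" using s t VW(5) by blast
    qed
    then show "\<exists>s. \<exists>F\<in>Pow {..<s}. f y \<inter> {..<s} = F \<and> ?R s F (g y \<inter> {..<s})" by blast
  next
    assume "\<exists>s. \<exists>F\<in>Pow {..<s}. f y \<inter> {..<s} = F \<and> ?R s F (g y \<inter> {..<s})"
    then show "(f y, g y) \<in> U" by blast
  qed
  have "Measurable.pred M (\<lambda>y. f y \<inter> {..<s} = F)" for s F
    by (rule pred_initial_segment[OF assms(1)])
  moreover have "Measurable.pred M (\<lambda>y. ?R s F (g y \<inter> {..<s}))" for s F
    by (rule pred_initial_segment[OF assms(2), where R="?R s F"])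
  ultimately have "Measurable.pred M (\<lambda>y. \<exists>s. \<exists>F\<in>Pow {..<s}. f y \<inter> {..<s} = F \<and> ?R s F (g y \<inter> {..<s}))"
    by (intro pred_intros_countable pred_intros_finite pred_intros_logic(2-6)) auto
  then show "(\<lambda>y. (f y, g y)) -` U \<inter> space M \<in> sets M"
    unfolding eq[symmetric] pred_def by (simp add: vimage_def Int_def conj_commute)
qed (auto dest: openin_subset)

text \<open>The map from \<open>y\<close> to the tree of attempts is Borel, and so are the jump and
  the functional that computes the pair from it; their composition is the reduction.\<close>

theorem Pi11_reduces_to_generic_ge:
  assumes "metrizable_space Y" "Pi11 Y P"
  shows "borel_reduces Y P (prod_topology cantor_space cantor_space) {(A, B). A \<ge>\<^sub>g B}"
proof -
  obtain S d where Sd: "Metric_space S d" and Y: "Y = Metric_space.mtopology S d"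
    using assms(1) unfolding metrizable_space_def by blast
  interpret Metric_space S d by (rule Sd)
  have top: "topspace Y = S" by (simp add: Y)
  have "Sigma11 Y (topspace Y - P)" using assms(2) by (simp add: Pi11_def)
  then obtain F where F: "closedin (prod_topology Y baire_space) F"
    and proj: "\<And>y. y \<in> topspace Y - P \<longleftrightarrow> (\<exists>z. (y, z) \<in> F)"
    by (rule Sigma11E) blast
  have FS: "y \<in> S" if "(y, z) \<in> F" for y z using closedin_subset[OF F] that top by auto
  \<comment> \<open>Asking only for a point \<open>y'\<close> near \<open>y\<close> makes the
    condition open in \<open>y\<close>. As the distance shrinks with the length and \<open>F\<close>
    is closed, the paths are still exactly the witnesses for \<open>y\<close>.\<close>
  define T where "T y = {s. \<exists>y' z. (y', z) \<in> F \<and> d y' y < inverse (real (Suc (length s))) \<and>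
      map z [0..<length s] = s}" for y
  have tree: "is_tree (T y)" for y
    unfolding is_tree_def
  proof (intro allI impI)
    fix s t assume "s @ t \<in> T y"
    then obtain y' z where z: "(y', z) \<in> F" "d y' y < inverse (real (Suc (length (s @ t))))"
      "map z [0..<length (s @ t)] = s @ t" unfolding T_def by blast
    have "d y' y < inverse (real (Suc (length s)))"
      by (rule order_less_le_trans[OF z(2)], rule le_imp_inverse_le) simp_all
    moreover have "map z [0..<length s] = s"
      using arg_cong[OF z(3), of "take (length s)"] by (simp add: take_map)
    ultimately show "s \<in> T y"
      unfolding T_def mem_Collect_eq using z(1) by blast
  qed
  have path: "well_founded_tree (T y) \<longleftrightarrow> y \<in> P" if y: "y \<in> S" for y
  proof -
    have "(\<exists>f. \<forall>n. map f [0..<n] \<in> T y) \<longleftrightarrow> (\<exists>z. (y, z) \<in> F)"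
    proof
      assume "\<exists>z. (y, z) \<in> F"
      then obtain z where "(y, z) \<in> F" ..
      then have "map z [0..<n] \<in> T y" for n
        unfolding T_def using y by (auto intro!: exI[of _ y] exI[of _ z])
      then show "\<exists>f. \<forall>n. map f [0..<n] \<in> T y" by blast
    next
      assume "\<exists>f. \<forall>n. map f [0..<n] \<in> T y"
      then obtain f where f: "\<And>n. map f [0..<n] \<in> T y" by blast
      have "(y, f) \<in> F"
      proof (rule ccontr)
        assume "(y, f) \<notin> F"
        then have "(y, f) \<in> topspace (prod_topology Y baire_space) - F" using y by (simp add: top)
        moreover have "openin (prod_topology Y baire_space) (topspace (prod_topology Y baire_space) - F)"
          using F by blast
        ultimately obtain U V where U: "openin Y U" "y \<in> U" and V: "openin baire_space V" "f \<in> V"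
          and UV: "U \<times> V \<subseteq> topspace (prod_topology Y baire_space) - F"
          unfolding openin_prod_topology_alt by metis
        obtain r where r: "r > 0" "mball y r \<subseteq> U"
          using U unfolding Y openin_mtopology by blast
        obtain m where m: "inverse (real (Suc m)) < r" using r(1) reals_Archimedean by blast
        obtain s where s: "\<And>g. (\<And>i. i < s \<Longrightarrow> g i = f i) \<Longrightarrow> g \<in> V"
          using openin_discrete_product[OF V[unfolded baire_space_def]] by blast
        \<comment> \<open>A node long enough for both the ball and the cylinder gives a point of
          \<open>F\<close> in \<open>U \<times> V\<close>.\<close>
        obtain y' z where z: "(y', z) \<in> F" "d y' y < inverse (real (Suc (max m s)))"
          "map z [0..<max m s] = map f [0..<max m s]"
          using f[of "max m s"] unfolding T_def by auto
        have "inverse (real (Suc (max m s))) \<le> inverse (real (Suc m))"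
          by (rule le_imp_inverse_le) simp_all
        then have "d y' y < r" using z(2) m by linarith
        then have "y' \<in> mball y r" using y FS[OF z(1)] by (simp add: commute)
        moreover have "z \<in> V" using z(3) by (intro s) (simp add: map_eq_conv)
        ultimately show False using r(2) UV z(1) by blast
      qed
      then show "\<exists>z. (y, z) \<in> F" by blast
    qed
    then show ?thesis unfolding well_founded_tree_def using proj[of y] y by (auto simp: top)
  qed
  define X where "X y = tree_code (T y)" for y
  have "Measurable.pred (borel_of Y) (\<lambda>y. n \<in> X y)" for n
  proof -
    define s where "s = list_decode n"
    have "n \<in> X y \<longleftrightarrow> s \<in> T y" for y
      unfolding X_def tree_code_def s_def by (metis image_iff list_decode_inverse list_encode_inverse)
    \<comment> \<open>The balls are centred at the points that have a witness extending
      \<open>s\<close>, so each bit of the tree is an open condition on \<open>y\<close>.\<close>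
    then have "{y \<in> topspace Y. n \<in> X y} =
        (\<Union>y'\<in>{y'. \<exists>z. (y', z) \<in> F \<and> map z [0..<length s] = s}. mball y' (inverse (real (Suc (length s)))))"
      by (intro set_eqI) (use FS in \<open>simp add: T_def top; blast\<close>)
    also have "openin Y \<dots>" unfolding Y by (intro openin_Union) auto
    finally show ?thesis unfolding pred_def space_borel_of by (rule openin_in_borel_of)
  qed
  note jump = pred_jump[OF this]
  obtain \<Phi> where \<Phi>: "\<And>X. computes (run \<Phi> (jump X)) (join (real_A X (generic X)) (real_B X (generic X)))"
    using join_computed_from_jump by blast
  have join: "n \<in> join (real_A X (generic X)) (real_B X (generic X)) \<longleftrightarrow> run \<Phi> (jump X) n = Some 1" for n X
    using \<Phi>[of X] unfolding computes_def by simp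
  have "n \<in> real_A X (generic X) \<longleftrightarrow> run \<Phi> (jump X) (2 * n) = Some 1"
    and "n \<in> real_B X (generic X) \<longleftrightarrow> run \<Phi> (jump X) (2 * n + 1) = Some 1" for n X
    unfolding join[symmetric] by (auto simp: join_def; presburger)+
  then have "Measurable.pred (borel_of Y) (\<lambda>y. n \<in> real_A (X y) (generic (X y)))"
    "Measurable.pred (borel_of Y) (\<lambda>y. n \<in> real_B (X y) (generic (X y)))" for n
    using pred_run[OF jump] by simp_all
  from measurable_cantor_prod[OF this]
  show ?thesis
    unfolding borel_reduces_def
    using generic_ge_iff_well_founded[OF tree] path by (intro bexI) (auto simp: X_def top)
qed

theorem mainTheorem2:
  shows "(\<exists>\<Phi>. \<forall>T. is_tree T \<longrightarrow>
            (\<exists>A B. computes (run \<Phi> (jump (tree_code T))) (join A B) \<and>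
                   (A \<ge>\<^sub>g B \<longleftrightarrow> well_founded_tree T))) \<and>
         Pi11_complete (prod_topology cantor_space cantor_space) {(A, B). A \<ge>\<^sub>g B}"
proof
  show "\<exists>\<Phi>. \<forall>T. is_tree T \<longrightarrow>
      (\<exists>A B. computes (run \<Phi> (jump (tree_code T))) (join A B) \<and> (A \<ge>\<^sub>g B \<longleftrightarrow> well_founded_tree T))"
    using join_computed_from_jump generic_ge_iff_well_founded by meson
  show "Pi11_complete (prod_topology cantor_space cantor_space) {(A, B). A \<ge>\<^sub>g B}"
    unfolding Pi11_complete_def polish_topology_def
    using Pi11_generic_ge Pi11_reduces_to_generic_ge completely_metrizable_imp_metrizable_space by blast
qed

end
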